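(* Let $n\ge 4$ and $k\ge 1$, let $\tilde R$ be a quiver on $[1,n-1]$ with $b_{ij}(\tilde R)\ge 2$ whenever $i<j$, and let $Q$ be the quiver on $[1,n]$ whose full subquiver on $[1,n-1]$ is obtained from $\tilde R$ by mutating successively at $2,1,2,1,\dots,2,1$ ($2k$ mutations, starting with $2$), and whose entries $b_{in}(Q)\ge 2$ ($1\le i\le n-1$) are arbitrary. Then $Q$ does not lie on any mutation cycle of length $\le 4k+1$. Consequently, the mutation cycle of length $4k+n$ based at $Q$ given by mutating successively at $$n,\ 1,2,\dots,1,2\ (2k\text{ terms}),\ n-1,n-2,\dots,2,1,\ 2,1,\dots,2,1\ (2k\text{ terms})$$ cannot be paved by mutation cycles of length $\le 4k+1$.
   Context: A quiver on $[1,n]$ is a finite directed multigraph with no loops and no oriented 2-cycles; quivers are labeled. It is encoded by the skew-symmetric matrix $B(Q)=(b_{ij})$, $b_{ij}>0$ meaning $b_{ij}$ arrows from $i$ to $j$. Mutation at $k$: $\mu[k](Q)$ has $b'_{ij}=-b_{ij}$ if $k\in\{i,j\}$ and $b'_{ij}=b_{ij}+\tfrac12(|b_{ik}|b_{kj}+b_{ik}|b_{kj}|)$ otherwise. The mutation graph has as vertices the quivers mutation-equivalent to $Q$, with an edge labeled $i$ joining $Q'$ and $\mu[i](Q')$. A mutation cycle of length $N$ based at a quiver $P$ is a sequence $i_1,\dots,i_N$ of vertices with consecutive entries distinct (cyclically, $i_N\ne i_1$), no mutation applied at an isolated vertex, such that mutating $P$ successively at $i_1,\dots,i_N$ returns $P$;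 a quiver lies on a mutation cycle if it is one of the quivers visited by it. A closed walk in the mutation graph is paved by mutation cycles of length $\le L$ if it becomes null-homotopic in the 2-complex obtained from the mutation graph by attaching a 2-cell along every mutation cycle of length $\le L$. *)

theory Defs
  imports "HOL-Analysis.Analysis"
begin

section \<open>Quivers and mutations\<close>

text \<open>A quiver is its exchange matrix, extended by 0 outside the vertex set \<open>{1..n}\<close>, so that
  equality of labeled quivers is equality of functions.\<close>

type_synonym quiver = "nat \<Rightarrow> nat \<Rightarrow> int"

definition quiver_on :: "nat \<Rightarrow> quiver \<Rightarrow> bool" where
  "quiver_on n B \<longleftrightarrow>
     (\<forall>i j. B j i = - B i j) \<and> (\<forall>i j. i \<notin> {1..n} \<or> j \<notin> {1..n} \<longrightarrow> B i j = 0)"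

definition full_subquiver :: "nat \<Rightarrow> quiver \<Rightarrow> quiver" where
  "full_subquiver m B = (\<lambda>i j. if i \<in> {1..m} \<and> j \<in> {1..m} then B i j else 0)"

text \<open>The division is exact: the sum is 0 if the two factors have opposite signs, and
  \<open>\<plusminus> 2 * B i k * B k j\<close> otherwise.\<close>

definition mutate :: "nat \<Rightarrow> quiver \<Rightarrow> quiver" where
  "mutate k B = (\<lambda>i j. if k = i \<or> k = j then - B i j
     else B i j + (\<bar>B i k\<bar> * B k j + B i k * \<bar>B k j\<bar>) div 2)"

text \<open>The first vertex of the list is mutated first.\<close>

abbreviation mutate_seq :: "nat list \<Rightarrow> quiver \<Rightarrow> quiver" where
  "mutate_seq ks B \<equiv> fold mutate ks B"

definition isolated :: "nat \<Rightarrow> quiver \<Rightarrow> bool" where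
  "isolated i B \<longleftrightarrow> (\<forall>j. B i j = 0)"

definition mutation_class :: "nat \<Rightarrow> quiver \<Rightarrow> quiver set" where
  "mutation_class n Q = {mutate_seq ks Q | ks. set ks \<subseteq> {1..n}}"

definition mutation_cycle :: "nat \<Rightarrow> quiver \<Rightarrow> nat list \<Rightarrow> bool" where
  "mutation_cycle n P ks \<longleftrightarrow>
     quiver_on n P \<and> ks \<noteq> [] \<and> set ks \<subseteq> {1..n} \<and>
     (\<forall>m < length ks. ks ! m \<noteq> ks ! (Suc m mod length ks)) \<and>
     (\<forall>m < length ks. \<not> isolated (ks ! m) (mutate_seq (take m ks) P)) \<and>
     mutate_seq ks P = P"

definition visited :: "quiver \<Rightarrow> nat list \<Rightarrow> quiver set" where
  "visited P ks = {mutate_seq (take m ks) P | m. m \<le> length ks}"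

definition lies_on_cycle :: "nat \<Rightarrow> quiver \<Rightarrow> quiver \<Rightarrow> nat list \<Rightarrow> bool" where
  "lies_on_cycle n Q P ks \<longleftrightarrow> mutation_cycle n P ks \<and> Q \<in> visited P ks"


section \<open>Quotient spaces\<close>

text \<open>\<open>glue_class X r x\<close> is the class of \<open>x\<close> under the equivalence relation generated by the
  restriction of \<open>r\<close> to \<open>X\<close>.\<close>

definition glue_class :: "'a topology \<Rightarrow> ('a \<times> 'a) set \<Rightarrow> 'a \<Rightarrow> 'a set" where
  "glue_class X r x = (let s = Restr r (topspace X) in (s \<union> s\<inverse>)\<^sup>* `` {x})"

definition glue_topology :: "'a topology \<Rightarrow> ('a \<times> 'a) set \<Rightarrow> 'a set topology" where
  "glue_topology X r = topology (\<lambda>U. U \<subseteq> glue_class X r ` topspace X \<and>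
     openin X {x \<in> topspace X. glue_class X r x \<in> U})"

lemma openin_glue_topology:
  "openin (glue_topology X r) U \<longleftrightarrow>
     U \<subseteq> glue_class X r ` topspace X \<and> openin X {x \<in> topspace X. glue_class X r x \<in> U}"
proof -
  have 1: "{x \<in> topspace X. glue_class X r x \<in> S \<inter> T} =
      {x \<in> topspace X. glue_class X r x \<in> S} \<inter> {x \<in> topspace X. glue_class X r x \<in> T}" for S T
    by auto
  have 2: "{x \<in> topspace X. glue_class X r x \<in> \<Union>K} =
      (\<Union>S\<in>K. {x \<in> topspace X. glue_class X r x \<in> S})" for K
    by auto
  have "istopology (\<lambda>U. U \<subseteq> glue_class X r ` topspace X \<and>
     openin X {x \<in> topspace X. glue_class X r x \<in> U})"
    unfolding istopology_def 1 2 by blast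
  then show ?thesis
    by (simp add: glue_topology_def)
qed

lemma topspace_glue_topology: "topspace (glue_topology X r) = glue_class X r ` topspace X"
proof (rule antisym)
  show "topspace (glue_topology X r) \<subseteq> glue_class X r ` topspace X"
    using openin_glue_topology openin_topspace by blast
  have "{x \<in> topspace X. glue_class X r x \<in> glue_class X r ` topspace X} = topspace X"
    by auto
  then have "openin (glue_topology X r) (glue_class X r ` topspace X)"
    by (simp add: openin_glue_topology)
  then show "glue_class X r ` topspace X \<subseteq> topspace (glue_topology X r)"
    by (rule openin_subset)
qed

lemma quotient_map_glue_class: "quotient_map X (glue_topology X r) (glue_class X r)"
  by (auto simp: quotient_map_def topspace_glue_topology openin_glue_topology)

lemma glue_class_eqI:
  assumes "(x, y) \<in> r" "x \<in> topspace X" "y \<in> topspace X"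
  shows "glue_class X r x = glue_class X r y"
proof -
  define s where "s = Restr r (topspace X)"
  have xy: "(x, y) \<in> s \<union> s\<inverse>" "(y, x) \<in> s \<union> s\<inverse>"
    using assms by (auto simp: s_def)
  show ?thesis
    unfolding glue_class_def s_def[symmetric] Let_def
    using xy by (auto intro: converse_rtrancl_into_rtrancl)
qed


section \<open>The mutation graph with mutation cycles filled in\<close>

text \<open>\<open>Edge P i\<close> is the edge labeled \<open>i\<close> at \<open>P\<close>, directed from \<open>P\<close> to \<open>mutate i P\<close>; it is glued
  below to the reversed \<open>Edge (mutate i P) i\<close>. \<open>Face P ks\<close> is the 2-cell attached along the
  mutation cycle \<open>ks\<close> based at \<open>P\<close>. The same closed walk read from another base point or backwards
  carries a 2-cell of its own, which does not affect null-homotopy of loops.\<close>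

datatype cell = Vertex quiver | Edge quiver nat | Face quiver "nat list"

fun closed_cell :: "cell \<Rightarrow> complex set" where
  "closed_cell (Vertex P) = {0}"
| "closed_cell (Edge P i) = closed_segment 0 1"
| "closed_cell (Face P ks) = cball 0 1"

definition cells :: "nat \<Rightarrow> nat \<Rightarrow> quiver \<Rightarrow> cell set" where
  "cells n L Q = Vertex ` mutation_class n Q
     \<union> {Edge P i | P i. P \<in> mutation_class n Q \<and> i \<in> {1..n}}
     \<union> {Face P ks | P ks. P \<in> mutation_class n Q \<and> mutation_cycle n P ks \<and> length ks \<le> L}"

text \<open>The walk from \<open>P\<close> along the edges labeled by \<open>ks\<close>, at constant speed over the time interval
  \<open>[0, 1]\<close>: during \<open>[m / N, (m + 1) / N]\<close>, where \<open>N = length ks\<close>, it runs along the edge labeled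
  \<open>ks ! m\<close> of the quiver reached after \<open>m\<close> mutations.\<close>

definition walk_point :: "quiver \<Rightarrow> nat list \<Rightarrow> real \<Rightarrow> cell \<times> complex" where
  "walk_point P ks s = (if ks = [] then (Vertex P, 0) else
     let N = length ks; m = min (nat \<lfloor>s * real N\<rfloor>) (N - 1)
     in (Edge (mutate_seq (take m ks) P) (ks ! m), of_real (s * real N - real m)))"

text \<open>The side condition in the third set only concerns mutations at isolated vertices, whose edge
  is a loop and is not to be folded in half.\<close>

definition gluing :: "((cell \<times> complex) \<times> (cell \<times> complex)) set" where
  "gluing =
     {((Edge P i, 0), (Vertex P, 0)) | P i. True}
   \<union> {((Edge P i, 1), (Vertex (mutate i P), 0)) | P i. True}
   \<union> {((Edge P i, of_real t), (Edge (mutate i P) i, of_real (1 - t))) | P i t.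
        mutate i P \<noteq> P \<and> 0 \<le> t \<and> t \<le> 1}
   \<union> {((Face P ks, cis (2 * pi * s)), walk_point P ks s) | P ks s. 0 \<le> s \<and> s \<le> 1}"

definition disjoint_cells :: "nat \<Rightarrow> nat \<Rightarrow> quiver \<Rightarrow> (cell \<times> complex) topology" where
  "disjoint_cells n L Q = sum_topology (\<lambda>c. top_of_set (closed_cell c)) (cells n L Q)"

definition mutation_complex :: "nat \<Rightarrow> nat \<Rightarrow> quiver \<Rightarrow> (cell \<times> complex) set topology" where
  "mutation_complex n L Q = glue_topology (disjoint_cells n L Q) gluing"

definition walk_path :: "nat \<Rightarrow> nat \<Rightarrow> quiver \<Rightarrow> nat list \<Rightarrow> real \<Rightarrow> (cell \<times> complex) set" where
  "walk_path n L Q ks s = glue_class (disjoint_cells n L Q) gluing (walk_point Q ks s)"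

text \<open>Null-homotopy is homotopy through closed paths to a constant path, as in
  \<^const>\<open>homotopic_loops\<close>, which is only available in subspaces of a type class topology.\<close>

definition paved :: "nat \<Rightarrow> nat \<Rightarrow> quiver \<Rightarrow> nat list \<Rightarrow> bool" where
  "paved n L Q ks \<longleftrightarrow>
     (\<exists>c. homotopic_with (\<lambda>p. p 1 = p 0) (top_of_set {0..1}) (mutation_complex n L Q)
        (walk_path n L Q ks) (\<lambda>_. c))"

lemma topspace_disjoint_cells: "topspace (disjoint_cells n L Q) = Sigma (cells n L Q) closed_cell"
  by (auto simp: disjoint_cells_def)

lemma continuous_map_cell:
  assumes "c \<in> cells n L Q" "continuous_map Z euclidean f" "f ` topspace Z \<subseteq> closed_cell c"
  shows "continuous_map Z (mutation_complex n L Q)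
           (\<lambda>z. glue_class (disjoint_cells n L Q) gluing (c, f z))"
proof -
  have "continuous_map Z (top_of_set (closed_cell c)) f"
    using assms by (auto simp: continuous_map_in_subtopology)
  moreover have "continuous_map (top_of_set (closed_cell c)) (disjoint_cells n L Q) (Pair c)"
    unfolding disjoint_cells_def
    using assms(1) by (rule continuous_map_component_injection)
  moreover have "continuous_map (disjoint_cells n L Q) (mutation_complex n L Q)
      (glue_class (disjoint_cells n L Q) gluing)"
    unfolding mutation_complex_def
    by (rule quotient_imp_continuous_map[OF quotient_map_glue_class])
  ultimately have "continuous_map Z (mutation_complex n L Q)
      (glue_class (disjoint_cells n L Q) gluing \<circ> (Pair c \<circ> f))"
    by (blast intro: continuous_map_compose)
  then show ?thesis
    by (simp add: o_def)
qed

lemma mutate_seq_take_in_class: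
  "set ks \<subseteq> {1..n} \<Longrightarrow> mutate_seq (take m ks) Q \<in> mutation_class n Q"
  unfolding mutation_class_def using set_take_subset by fastforce

lemma Edge_start:
  assumes "P \<in> mutation_class n Q" "i \<in> {1..n}"
  shows "glue_class (disjoint_cells n L Q) gluing (Edge P i, 0) =
         glue_class (disjoint_cells n L Q) gluing (Vertex P, 0)"
  by (rule glue_class_eqI) (use assms in \<open>auto simp: gluing_def topspace_disjoint_cells cells_def\<close>)

lemma mutate_in_class:
  assumes "P \<in> mutation_class n Q" "i \<in> {1..n}"
  shows "mutate i P \<in> mutation_class n Q"
proof -
  obtain ks where "P = mutate_seq ks Q" "set ks \<subseteq> {1..n}"
    using assms by (auto simp: mutation_class_def)
  then have "mutate i P = mutate_seq (ks @ [i]) Q" "set (ks @ [i]) \<subseteq> {1..n}"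
    using assms by auto
  then show ?thesis
    unfolding mutation_class_def by blast
qed

lemma Edge_end:
  assumes "P \<in> mutation_class n Q" "i \<in> {1..n}"
  shows "glue_class (disjoint_cells n L Q) gluing (Edge P i, 1) =
         glue_class (disjoint_cells n L Q) gluing (Vertex (mutate i P), 0)"
  by (rule glue_class_eqI)
    (use assms mutate_in_class[OF assms] in
      \<open>auto simp: gluing_def topspace_disjoint_cells cells_def\<close>)

lemma walk_piece:
  assumes "ks \<noteq> []" "0 \<le> s" "s \<le> 1"
  obtains m where "m < length ks" "real m \<le> s * real (length ks)"
    "s * real (length ks) \<le> real m + 1"
    "walk_point P ks s = (Edge (mutate_seq (take m ks) P) (ks ! m),
       of_real (s * real (length ks) - real m))"
proof -
  define N where "N = length ks"
  define m where "m = min (nat \<lfloor>s * real N\<rfloor>) (N - 1)"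
  have N: "N > 0" using assms by (simp add: N_def)
  have sN: "0 \<le> s * real N" "s * real N \<le> real N"
    using assms N by (auto simp: mult_left_le_one_le)
  have a: "real (nat \<lfloor>s * real N\<rfloor>) \<le> s * real N" "s * real N \<le> real (nat \<lfloor>s * real N\<rfloor>) + 1"
    using sN by linarith+
  have "real m \<le> s * real N" "m < N"
    using a N by (auto simp: m_def min_def)
  moreover have "s * real N \<le> real m + 1"
    using a sN N by (auto simp: m_def min_def of_nat_diff)
  moreover have "walk_point P ks s = (Edge (mutate_seq (take m ks) P) (ks ! m),
       of_real (s * real N - real m))"
    using assms(1) by (simp add: walk_point_def N_def m_def Let_def)
  ultimately show ?thesis
    using that unfolding N_def by blast
qed

lemma walk_path_0:
  assumes "set ks \<subseteq> {1..n}"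
  shows "walk_path n L Q ks 0 = glue_class (disjoint_cells n L Q) gluing (Vertex Q, 0)"
proof (cases "ks = []")
  case False
  then have "ks ! 0 \<in> {1..n}" using assms by (cases ks) auto
  then have "glue_class (disjoint_cells n L Q) gluing (Edge Q (ks ! 0), 0) =
         glue_class (disjoint_cells n L Q) gluing (Vertex Q, 0)"
    using Edge_start[OF mutate_seq_take_in_class[OF assms, of 0]] by simp
  then show ?thesis
    using False by (simp add: walk_path_def walk_point_def)
qed (simp add: walk_path_def walk_point_def)

lemma walk_path_1:
  assumes "set ks \<subseteq> {1..n}"
  shows "walk_path n L Q ks 1 =
    glue_class (disjoint_cells n L Q) gluing (Vertex (mutate_seq ks Q), 0)"
proof (cases "ks = []")
  case False
  define m where "m = length ks - 1"
  have m: "m < length ks" "length ks = Suc m" using False by (auto simp: m_def)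
  then have i: "ks ! m \<in> {1..n}" using assms nth_mem by blast
  have e: "mutate_seq ks Q = mutate (ks ! m) (mutate_seq (take m ks) Q)"
  proof -
    have "ks = take m ks @ [ks ! m]"
      using take_Suc_conv_app_nth[OF m(1)] m(2) by simp
    then have "mutate_seq ks Q = mutate_seq (take m ks @ [ks ! m]) Q"
      by metis
    then show ?thesis by simp
  qed
  have "min (nat \<lfloor>1 * real (length ks)\<rfloor>) (length ks - 1) = m"
    using m by simp
  then have "walk_point Q ks 1 = (Edge (mutate_seq (take m ks) Q) (ks ! m), 1)"
    using False m by (simp add: walk_point_def Let_def)
  then show ?thesis
    unfolding walk_path_def e
    using Edge_end[OF mutate_seq_take_in_class[OF assms] i] by simp
qed (simp add: walk_path_def walk_point_def)

lemma continuous_map_walk_path: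
  assumes "set ks \<subseteq> {1..n}"
  shows "continuous_map (top_of_set {0..1}) (mutation_complex n L Q) (walk_path n L Q ks)"
proof (cases "ks = []")
  case True
  have "Vertex Q \<in> cells n L Q"
    using mutate_seq_take_in_class[of "[]" n 0 Q] by (simp add: cells_def)
  then show ?thesis
    using continuous_map_cell[of "Vertex Q" n L Q "top_of_set {0..1::real}" "\<lambda>_. 0"] True
    by (simp add: walk_path_def[abs_def] walk_point_def image_subset_iff)
next
  case False
  define N where "N = length ks"
  have N: "N > 0" using False by (simp add: N_def)
  define T where "T = (\<lambda>m. {real m / real N .. (real m + 1) / real N} :: real set)"
  define E where "E = (\<lambda>m. Edge (mutate_seq (take m ks) Q) (ks ! m))"
  define f where "f = (\<lambda>m s. glue_class (disjoint_cells n L Q) gluing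
      (E m, complex_of_real (s * real N - real m)))"
  have i: "ks ! m \<in> {1..n}" if "m < N" for m
    using that assms nth_mem unfolding N_def by blast
  have T: "s \<in> T m \<longleftrightarrow> real m \<le> s * real N \<and> s * real N \<le> real m + 1" for s m
    using N by (auto simp: T_def field_simps)
  have agree: "f a s = f b s" if "a < N" "b < N" "a < b" "s \<in> T a" "s \<in> T b" for a b s
  proof -
    have "b = Suc a" "s * real N = real a + 1"
      using that by (auto simp: T)
    then have "s * real N - real a = 1" "s * real N - real b = 0" "b = Suc a"
      by simp_all
    moreover have "mutate_seq (take (Suc a) ks) Q = mutate (ks ! a) (mutate_seq (take a ks) Q)"
      using that(1) by (simp add: N_def take_Suc_conv_app_nth)
    ultimately show ?thesis
      unfolding f_def E_def
      using Edge_end[OF mutate_seq_take_in_class[OF assms, of a] i[OF that(1)], where L = L]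
        Edge_start[OF mutate_seq_take_in_class[OF assms, of b] i[OF that(2)], where L = L]
      by (metis of_real_0 of_real_1)
  qed
  show ?thesis
  proof (rule pasting_lemma_closed[where I = "{..<N}" and T = "\<lambda>m. {0..1} \<inter> T m" and f = f])
    show "closedin (top_of_set {0..1}) ({0..1} \<inter> T m)" for m
      by (rule closedin_closed_Int) (simp add: T_def)
    show "continuous_map (subtopology (top_of_set {0..1}) ({0..1} \<inter> T m)) (mutation_complex n L Q) (f m)"
      if "m \<in> {..<N}" for m
      unfolding f_def
    proof (rule continuous_map_cell)
      show "E m \<in> cells n L Q"
        using mutate_seq_take_in_class[OF assms, of m] i that by (auto simp: cells_def E_def)
      show "continuous_map (subtopology (top_of_set {0..1}) ({0..1} \<inter> T m)) euclidean
          (\<lambda>s. complex_of_real (s * real N - real m))"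
        by (auto simp: subtopology_subtopology intro!: continuous_intros)
      show "(\<lambda>s. complex_of_real (s * real N - real m)) `
          topspace (subtopology (top_of_set {0..1}) ({0..1} \<inter> T m)) \<subseteq> closed_cell (E m)"
      proof clarsimp
        fix s assume "s \<in> T m"
        then have "s * real N - real m \<in> closed_segment 0 1"
          by (auto simp: T closed_segment_eq_real_ivl)
        then have "complex_of_real (s * real N - real m) \<in> closed_segment (of_real 0) (of_real 1)"
          by (simp only: of_real_closed_segment)
        then show "complex_of_real s * of_nat N - of_nat m \<in> closed_cell (E m)"
          by (simp add: E_def)
      qed
    qed
    show "f a s = f b s" if "a \<in> {..<N}" "b \<in> {..<N}"
      "s \<in> topspace (top_of_set {0..1}) \<inter> ({0..1} \<inter> T a) \<inter> ({0..1} \<inter> T b)" for a b s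
      using that agree by (metis IntE lessThan_iff linorder_neqE_nat)
    show "\<exists>m. m \<in> {..<N} \<and> s \<in> {0..1} \<inter> T m \<and> walk_path n L Q ks s = f m s"
      if s: "s \<in> topspace (top_of_set {0..1})" for s
    proof -
      obtain m where "m < N" "real m \<le> s * real N" "s * real N \<le> real m + 1"
        "walk_point Q ks s = (E m, of_real (s * real N - real m))"
        using walk_piece[OF False, of s Q] s unfolding N_def E_def by auto
      then show ?thesis
        using s by (intro exI[of _ m]) (auto simp: T f_def walk_path_def)
    qed
  qed auto
qed

lemma paved_short_cycle:
  assumes "mutation_cycle n Q ks" "length ks \<le> L"
  shows "paved n L Q ks"
proof -
  define K where "K = glue_class (disjoint_cells n L Q) gluing"
  have ks: "set ks \<subseteq> {1..n}" "ks \<noteq> []"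
    using assms by (auto simp: mutation_cycle_def)
  have "Q \<in> mutation_class n Q"
    using mutate_seq_take_in_class[OF ks(1), of 0 Q] by simp
  then have F: "Face Q ks \<in> cells n L Q"
    using assms by (auto simp: cells_def)
  define h where "h = (\<lambda>z::real \<times> real. K (Face Q ks, of_real (1 - fst z) * cis (2 * pi * snd z)))"
  have h: "continuous_map (prod_topology (top_of_set {0..1}) (top_of_set {0..1}))
      (mutation_complex n L Q) h"
    unfolding h_def K_def
  proof (rule continuous_map_cell[OF F])
    have "continuous_on ({0..1} \<times> {0..1}) (\<lambda>z::real \<times> real. of_real (1 - fst z) * cis (2 * pi * snd z))"
      by (intro continuous_intros)
    then show "continuous_map (prod_topology (top_of_set {0..1}) (top_of_set {0..1})) euclidean
        (\<lambda>z::real \<times> real. of_real (1 - fst z) * cis (2 * pi * snd z))"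
      by (simp only: prod_topology_subtopology_eu continuous_map_iff_continuous)
    show "(\<lambda>z::real \<times> real. of_real (1 - fst z) * cis (2 * pi * snd z)) `
        topspace (prod_topology (top_of_set {0..1}) (top_of_set {0..1})) \<subseteq> closed_cell (Face Q ks)"
      by (auto simp: norm_mult simp del: of_real_diff)
  qed
  have "homotopic_with (\<lambda>p. p 1 = p 0) (top_of_set {0..1}) (mutation_complex n L Q)
      (\<lambda>s. h (0, s)) (\<lambda>s. h (1, s))"
    unfolding homotopic_with_def
    by (rule exI[of _ h]) (use h in \<open>auto simp: h_def\<close>)
  moreover have "walk_path n L Q ks s = h (0, s)" if s: "s \<in> {0..1}" for s
  proof -
    obtain m where m: "m < length ks" "real m \<le> s * real (length ks)"
      "s * real (length ks) \<le> real m + 1"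
      "walk_point Q ks s = (Edge (mutate_seq (take m ks) Q) (ks ! m),
         of_real (s * real (length ks) - real m))"
      using walk_piece[OF ks(2), of s Q] s by auto
    have "s * real (length ks) - real m \<in> closed_segment 0 1"
      using m by (auto simp: closed_segment_eq_real_ivl)
    then have "complex_of_real (s * real (length ks) - real m) \<in> closed_segment (of_real 0) (of_real 1)"
      by (simp only: of_real_closed_segment)
    moreover have "ks ! m \<in> {1..n}"
      using m ks nth_mem by blast
    ultimately have "walk_point Q ks s \<in> topspace (disjoint_cells n L Q)"
      using m mutate_seq_take_in_class[OF ks(1), of m Q]
      by (auto simp: topspace_disjoint_cells cells_def)
    then have "K (Face Q ks, cis (2 * pi * s)) = K (walk_point Q ks s)"
      unfolding K_def
      by (intro glue_class_eqI)
        (use F s in \<open>auto simp: gluing_def topspace_disjoint_cells\<close>)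
    then show ?thesis
      by (simp add: walk_path_def h_def K_def)
  qed
  ultimately have "homotopic_with (\<lambda>p. p 1 = p 0) (top_of_set {0..1}) (mutation_complex n L Q)
      (walk_path n L Q ks) (\<lambda>_. K (Face Q ks, 0))"
    by (rule homotopic_with_eq) (auto simp: h_def)
  then show ?thesis
    unfolding paved_def by blast
qed

end

theory Submission
  imports Defs "HOL-Complex_Analysis.Winding_Numbers"
begin

text \<open>A mutation walk without backtracking that enters a fork other than through its point of return
  only meets forks afterwards, and a fork has no sink, whereas \<open>n\<close> is a sink of \<open>Q\<close>. Starting from
  either end point of the edge \<open>n\<close> at \<open>Q\<close>, every mutation other than the next one in the alternating
  sequence \<open>1, 2, 1, 2, \<dots>\<close> produces a fork during the first \<open>2k\<close> steps. Hence a mutation cycle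
  through \<open>Q\<close> consists of the edge \<open>n\<close> and two alternating pieces of \<open>2k\<close> mutations that cannot be
  joined directly, so its length exceeds \<open>4k + 1\<close>.

  Consequently no 2-cell touches the edge \<open>n\<close> at \<open>Q\<close>. Collapsing the complement of this edge maps
  the complex to a circle, and the long cycle, which crosses the edge once, to a loop of winding
  number 1.\<close>

text \<open>Along both rays the full subquiver on \<open>[1,n-1]\<close> is known exactly: the
  alternating letters undo, one at a time, the mutations that wound \<open>R\<close> up. The forced
  stretch lasts as long as there is something to unwind, which is where \<open>2k\<close> comes
  from. The column of \<open>n\<close> starts from arbitrary entries, so for the length bound it is
  controlled only by inequalities. These have to survive the next mutation of the ray and at the
  same time make every wrong turn a fork; the phases are chosen to do both. That the long sequence
  closes up is a separate matter and needs exact values. After \<open>2k\<close> steps both rays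
  carry \<open>R\<close> on \<open>[1,n-1]\<close> and differ only in the column of
  \<open>n\<close>. The sweep \<open>n-1,...,1\<close> restores \<open>R\<close> and corrects the
  column. Its entries at 1 and 2 match because one ray repeats the other with a delay of two steps,
  and the remaining entries match because of a conserved linear expression.\<close>

lemma mutate_apply:
  "mutate k B i j = (if k = i \<or> k = j then - B i j
     else if 0 < B i k \<and> 0 < B k j then B i j + B i k * B k j
     else if B i k < 0 \<and> B k j < 0 then B i j - B i k * B k j
     else B i j)"
proof -
  have "(\<bar>a\<bar> * b + a * \<bar>b\<bar>) div 2 =
    (if 0 < a \<and> 0 < b then a * b else if a < 0 \<and> b < 0 then - (a * b) else 0)" for a b :: int
    by (auto simp: abs_if mult_less_0_iff)
  then show ?thesis
    by (simp add: mutate_def)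
qed

lemma quiver_on_skew: "quiver_on n B \<Longrightarrow> B j i = - B i j"
  unfolding quiver_on_def by blast

lemma quiver_on_diag: "quiver_on n B \<Longrightarrow> B i i = 0"
  using quiver_on_skew[of n B i i] by simp

lemma quiver_on_outside: "quiver_on n B \<Longrightarrow> i \<notin> {1..n} \<or> j \<notin> {1..n} \<Longrightarrow> B i j = 0"
  unfolding quiver_on_def by blast

lemma quiver_on_ext:
  assumes "quiver_on n A" "quiver_on n B"
    and "\<And>i j. 1 \<le> i \<Longrightarrow> i < j \<Longrightarrow> j \<le> n \<Longrightarrow> A i j = B i j"
  shows "A = B"
proof (intro ext)
  fix i j
  show "A i j = B i j"
  proof (cases "i \<in> {1..n} \<and> j \<in> {1..n}")
    case True
    then show ?thesis
      using assms(3)[of i j] assms(3)[of j i] quiver_on_skew[OF assms(1), of i j]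
        quiver_on_skew[OF assms(2), of i j] quiver_on_diag[OF assms(1)] quiver_on_diag[OF assms(2)]
      by (cases i j rule: linorder_cases) auto
  next
    case False
    then show ?thesis
      using assms quiver_on_outside by metis
  qed
qed

lemma mutate_skew:
  assumes "\<And>i j. B j i = - B i j"
  shows "mutate k B j i = - mutate k B i j"
proof -
  have "B j i = - B i j" "B j k = - B k j" "B k i = - B i k"
    using assms by blast+
  then show ?thesis
    by (auto simp: mutate_apply)
qed

lemma quiver_on_mutate:
  assumes "quiver_on n B"
  shows "quiver_on n (mutate k B)"
proof -
  have "mutate k B j i = - mutate k B i j" for i j
    using quiver_on_skew[OF assms] by (rule mutate_skew)
  moreover have "mutate k B i j = 0" if "i \<notin> {1..n} \<or> j \<notin> {1..n}" for i j
  proof -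
    have "B i j = 0" "B i k = 0 \<or> B k j = 0"
      using quiver_on_outside[OF assms] that by blast+
    then show ?thesis
      by (auto simp: mutate_apply)
  qed
  ultimately show ?thesis
    unfolding quiver_on_def by blast
qed

lemma quiver_on_mutate_seq: "quiver_on n B \<Longrightarrow> quiver_on n (mutate_seq ks B)"
  by (induction ks arbitrary: B) (auto intro: quiver_on_mutate)

lemma mutate_mutate: "mutate k (mutate k B) = B"
proof (intro ext)
  fix i j
  show "mutate k (mutate k B) i j = B i j"
    by (simp add: mutate_apply)
qed

lemma mutate_seq_rev: "mutate_seq (rev ks) (mutate_seq ks B) = B"
  by (induction ks arbitrary: B) (auto simp: mutate_mutate)

lemma isolated_mutate: "isolated i B \<Longrightarrow> isolated i (mutate k B)"
  by (auto simp: isolated_def mutate_apply)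

text \<open>Mutation is an involution, so isolation passes in both directions. Along a whole walk it
  therefore suffices to inspect the base quiver.\<close>

lemma isolated_mutate_seq: "isolated i (mutate_seq ks B) \<longleftrightarrow> isolated i B"
proof (induction ks arbitrary: B)
  case (Cons k ks)
  then show ?case
    using isolated_mutate[of i B k] isolated_mutate[of i "mutate k B" k] by (auto simp: mutate_mutate)
qed simp

lemma full_subquiver_mutate:
  assumes "quiver_on n B" "k \<in> {1..m}"
  shows "full_subquiver m (mutate k B) = mutate k (full_subquiver m B)"
  using assms(2) by (intro ext) (auto simp: full_subquiver_def mutate_apply)

lemma mutate_sink:
  assumes "quiver_on n B" "\<And>j. B k j \<le> 0"
  shows "mutate k B i j = (if k = i \<or> k = j then - B i j else B i j)"
  using assms(2)[of i] assms(2)[of j] quiver_on_skew[OF assms(1), of k i]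
  by (auto simp: mutate_apply)


section \<open>Forks\<close>

definition directed_transitive :: "quiver \<Rightarrow> nat set \<Rightarrow> bool" where
  "directed_transitive B S \<longleftrightarrow>
     (\<forall>x\<in>S. \<forall>y\<in>S. \<forall>z\<in>S. B x y > 0 \<longrightarrow> B y z > 0 \<longrightarrow> B x z > 0)"

lemma directed_transitiveD:
  "directed_transitive B S \<Longrightarrow> x \<in> S \<Longrightarrow> y \<in> S \<Longrightarrow> z \<in> S \<Longrightarrow> B x y > 0 \<Longrightarrow> B y z > 0 \<Longrightarrow> B x z > 0"
  unfolding directed_transitive_def by blast

lemma directed_transitiveI:
  "(\<And>x y z. x \<in> S \<Longrightarrow> y \<in> S \<Longrightarrow> z \<in> S \<Longrightarrow> B x y > 0 \<Longrightarrow> B y z > 0 \<Longrightarrow> B x z > 0) \<Longrightarrow>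
     directed_transitive B S"
  unfolding directed_transitive_def by blast

text \<open>Warkentin's forks with point of return \<open>r\<close>. In a quiver without 0 entries off the diagonal,
  acyclicity of a full subquiver is transitivity of its arrows.\<close>

definition fork :: "nat \<Rightarrow> nat \<Rightarrow> quiver \<Rightarrow> bool" where
  "fork n r B \<longleftrightarrow> quiver_on n B \<and> r \<in> {1..n} \<and>
     (\<forall>i\<in>{1..n}. \<forall>j\<in>{1..n}. i \<noteq> j \<longrightarrow> \<bar>B i j\<bar> \<ge> 2) \<and>
     (\<exists>a. B a r > 0) \<and> (\<exists>b. B r b > 0) \<and>
     (\<forall>a b. B a r > 0 \<longrightarrow> B r b > 0 \<longrightarrow> B b a > B a r \<and> B b a > B r b) \<and>
     directed_transitive B {x. B x r > 0} \<and>
     directed_transitive B {x. B r x > 0}"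

text \<open>The condition on a quiver under which its mutation at \<open>i\<close> is a fork with point of
  return \<open>i\<close>; it is spelled out before mutating so that a single verification serves all cases.\<close>

definition opens_fork :: "nat \<Rightarrow> nat \<Rightarrow> quiver \<Rightarrow> bool" where
  "opens_fork n i B \<longleftrightarrow> quiver_on n B \<and> i \<in> {1..n} \<and>
     (\<forall>x\<in>{1..n}. \<forall>y\<in>{1..n}. x \<noteq> y \<longrightarrow> \<bar>B x y\<bar> \<ge> 2) \<and>
     (\<exists>a. B a i > 0) \<and> (\<exists>b. B i b > 0) \<and>
     (\<forall>a b. B a i > 0 \<longrightarrow> B i b > 0 \<longrightarrow>
        B a b + B a i * B i b > B a i \<and> B a b + B a i * B i b > B i b) \<and>
     directed_transitive B {x. B x i > 0} \<and>
     directed_transitive B {x. B i x > 0}"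

text \<open>Mutation at \<open>i\<close> exchanges its in- and out-neighbours and leaves the arrows
  inside either set alone. Only entries from an in-neighbour \<open>a\<close> to an out-neighbour
  \<open>b\<close> change, to \<open>B a b + B a i * B i b\<close>, and these are the arrows that
  must dominate in the fork.\<close>

lemma fork_mutate_if_opens_fork:
  assumes "opens_fork n i B"
  shows "fork n i (mutate i B)"
proof -
  have q: "quiver_on n B" and i: "i \<in> {1..n}"
    and abund: "\<And>x y. x \<in> {1..n} \<Longrightarrow> y \<in> {1..n} \<Longrightarrow> x \<noteq> y \<Longrightarrow> \<bar>B x y\<bar> \<ge> 2"
    and ex: "\<exists>a. B a i > 0" "\<exists>b. B i b > 0"
    and dom: "\<And>a b. B a i > 0 \<Longrightarrow> B i b > 0 \<Longrightarrow>
        B a b + B a i * B i b > B a i \<and> B a b + B a i * B i b > B i b"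
    and trans_in': "directed_transitive B {x. B x i > 0}"
    and trans_out': "directed_transitive B {x. B i x > 0}"
    using assms unfolding opens_fork_def by blast+
  have trans_in: "B x z > 0" if "B x i > 0" "B y i > 0" "B z i > 0" "B x y > 0" "B y z > 0" for x y z
    by (rule directed_transitiveD[OF trans_in', of x y z]) (use that in simp_all)
  have trans_out: "B x z > 0" if "B i x > 0" "B i y > 0" "B i z > 0" "B x y > 0" "B y z > 0" for x y z
    by (rule directed_transitiveD[OF trans_out', of x y z]) (use that in simp_all)
  let ?C = "mutate i B"
  note skew = quiver_on_skew[OF q]
  have C_i: "?C x i = B i x" "?C i x = B x i" for x
    using skew[of i x] skew[of x i] by (auto simp: mutate_apply)
  have cross: "?C a b = B a b + B a i * B i b" if "B a i > 0" "B i b > 0" for a b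
    using that quiver_on_diag[OF q, of i] by (auto simp: mutate_apply)
  have same_in: "?C x y = B x y" if "B x i > 0" "B y i > 0" for x y
    using that skew[of y i] quiver_on_diag[OF q, of i] by (auto simp: mutate_apply)
  have same_out: "?C x y = B x y" if "B i x > 0" "B i y > 0" for x y
    using that skew[of x i] quiver_on_diag[OF q, of i] by (auto simp: mutate_apply)
  have qC: "quiver_on n ?C" by (rule quiver_on_mutate[OF q])
  have "\<bar>?C x y\<bar> \<ge> 2" if xy: "x \<in> {1..n}" "y \<in> {1..n}" "x \<noteq> y" for x y
  proof -
    consider "x = i \<or> y = i" | "B x i > 0" "B y i > 0" | "B i x > 0" "B i y > 0"
      | "B x i > 0" "B i y > 0" | "B y i > 0" "B i x > 0"
      using abund[OF xy(1) i] abund[OF xy(2) i] skew[of x i] skew[of y i] by fastforce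
    then show ?thesis
    proof cases
      case 1
      then show ?thesis using abund[OF xy] by (auto simp: mutate_apply)
    next
      case 4
      have "x \<noteq> i" using 4 quiver_on_diag[OF q, of i] by auto
      then have "\<bar>B x i\<bar> \<ge> 2" using abund xy i by blast
      then show ?thesis using 4 cross[of x y] dom[of x y] by linarith
    next
      case 5
      have "y \<noteq> i" using 5 quiver_on_diag[OF q, of i] by auto
      then have "\<bar>B y i\<bar> \<ge> 2" using abund xy i by blast
      then show ?thesis
        using 5 cross[of y x] dom[of y x] quiver_on_skew[OF qC, of x y] by linarith
    qed (use abund[OF xy] same_in same_out in auto)
  qed
  moreover have "?C b a > ?C a i \<and> ?C b a > ?C i b" if "?C a i > 0" "?C i b > 0" for a b
    using that cross[of b a] dom[of b a] unfolding C_i by auto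
  moreover have directed_in: "directed_transitive ?C {x. ?C x i > 0}"
  proof (rule directed_transitiveI, unfold mem_Collect_eq)
    fix x y z
    assume that: "?C x i > 0" "?C y i > 0" "?C z i > 0" "?C x y > 0" "?C y z > 0"
    show "?C x z > 0"
      using that same_out[of x y] same_out[of y z] same_out[of x z] trans_out[of x y z] unfolding C_i by auto
  qed
  moreover have directed_out: "directed_transitive ?C {x. ?C i x > 0}"
  proof (rule directed_transitiveI, unfold mem_Collect_eq)
    fix x y z
    assume that: "?C i x > 0" "?C i y > 0" "?C i z > 0" "?C x y > 0" "?C y z > 0"
    show "?C x z > 0"
      using that same_in[of x y] same_in[of y z] same_in[of x z] trans_in[of x y z] unfolding C_i by auto
  qed
  ultimately show ?thesis
    using qC i ex unfolding fork_def C_i by blast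
qed


lemma int_mult_gt:
  fixes a b :: int
  assumes "2 \<le> a" "2 \<le> b"
  shows "a < a * b" "b < a * b"
  using assms by auto

text \<open>Suppose \<open>r\<close> points to \<open>i\<close>. Then \<open>i\<close> points to all
  in-neighbours of \<open>r\<close>, so whatever points to \<open>i\<close> is \<open>r\<close> or
  an out-neighbour of \<open>r\<close>. Domination and transitivity then leave one kind of pair
  \<open>a\<close>, \<open>b\<close> with \<open>B a b\<close> negative: \<open>a = r\<close> with
  \<open>b\<close> an in-neighbour of \<open>r\<close>. There \<open>B i b\<close> exceeds
  \<open>B b r\<close> by the fork inequality.\<close>

lemma opens_fork_if_fork:
  assumes "fork n r B" "i \<in> {1..n}" "i \<noteq> r"
  shows "opens_fork n i B"
proof -
  have q: "quiver_on n B" and r: "r \<in> {1..n}"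
    and abund: "\<And>x y. x \<in> {1..n} \<Longrightarrow> y \<in> {1..n} \<Longrightarrow> x \<noteq> y \<Longrightarrow> \<bar>B x y\<bar> \<ge> 2"
    and ex: "\<exists>a. B a r > 0" "\<exists>b. B r b > 0"
    and dom: "\<And>a b. B a r > 0 \<Longrightarrow> B r b > 0 \<Longrightarrow> B b a > B a r \<and> B b a > B r b"
    and trans_in': "directed_transitive B {x. B x r > 0}"
    and trans_out': "directed_transitive B {x. B r x > 0}"
    using assms(1) unfolding fork_def by blast+
  have trans_in: "B x z > 0" if "B x r > 0" "B y r > 0" "B z r > 0" "B x y > 0" "B y z > 0" for x y z
    by (rule directed_transitiveD[OF trans_in', of x y z]) (use that in simp_all)
  have trans_out: "B x z > 0" if "B r x > 0" "B r y > 0" "B r z > 0" "B x y > 0" "B y z > 0" for x y z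
    by (rule directed_transitiveD[OF trans_out', of x y z]) (use that in simp_all)
  note skew = quiver_on_skew[OF q]
  have inside: "x \<in> {1..n}" "y \<in> {1..n}" "x \<noteq> y" "B x y \<ge> 2" if "B x y > 0" for x y
  proof -
    show "x \<in> {1..n}" "y \<in> {1..n}"
      using quiver_on_outside[OF q, of x y] that by fastforce+
    moreover show "x \<noteq> y"
      using quiver_on_diag[OF q, of x] that by auto
    ultimately show "B x y \<ge> 2"
      using abund[of x y] that by simp
  qed
  have side: "x = r \<or> B x r > 0 \<or> B r x > 0" if "x \<in> {1..n}" for x
    using abund[OF that r] skew[of x r] by fastforce
  have pos: "B a b + B a i * B i b > B a i \<and> B a b + B a i * B i b > B i b"
    if "B a i > 0" "B i b > 0" "B a b > 0" for a b
    using int_mult_gt[of "B a i" "B i b"] inside(4)[OF that(1)] inside(4)[OF that(2)] that(3) by linarith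
  obtain a0 b0 where ab0: "B a0 r > 0" "B r b0 > 0" using ex by blast
  \<comment> \<open>The estimate for the critical pair: \<open>z\<close> is the weight of the
    opposing arrow, \<open>y * x\<close> the contribution of the path through
    \<open>i\<close>.\<close>
  have big: "y * x - z > x" if "2 \<le> y" "z < x" "0 < x" for x y z :: int
    using that mult_right_mono[of 2 y x] by linarith
  consider "B r i > 0" | "B i r > 0"
    using side[OF assms(2)] assms(3) by blast
  then show ?thesis
  proof cases
    case ri: 1
    have "B a b + B a i * B i b > B a i \<and> B a b + B a i * B i b > B i b"
      if a: "B a i > 0" and b: "B i b > 0" for a b
    proof (cases "B a b > 0")
      case True
      then show ?thesis using pos a b by blast
    next
      case False
      consider "a = r" | "B a r > 0" | "B r a > 0"
        using side inside[OF a] by blast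
      then show ?thesis
      proof cases
        case 1
        have "B b r > 0"
          using 1 False side[of b] inside[OF b] b ri skew[of r i] by force
        then show ?thesis
          using dom[of b i] ri 1 big[of "B r i" "B b r" "B i b"] skew[of r b] inside(4)[OF ri] b by auto
      next
        case 2
        then show ?thesis using dom[of a i] ri a skew[of a i] by auto
      next
        case 3
        have "b \<noteq> r" using b ri skew[of r i] by auto
        then consider "B b r > 0" | "B r b > 0"
          using side[of b] inside[OF b] by blast
        then have "B a b > 0"
          using dom[of b a] trans_out[of a i b] 3 ri a b by cases auto
        then show ?thesis using False by blast
      qed
    qed
    moreover have directed_in: "directed_transitive B {x. B x i > 0}"
    proof (rule directed_transitiveI, unfold mem_Collect_eq)
      fix x y z
      assume that: "B x i > 0" "B y i > 0" "B z i > 0" "B x y > 0" "B y z > 0"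
      show "B x z > 0"
      proof -
        have "w = r \<or> B r w > 0" if w: "B w i > 0" for w
          using side[of w] inside[OF w] dom[of w i] ri w skew[of w i] by force
        moreover have "z \<noteq> r"
          using calculation[OF that(2)] that(5) skew[of z y] quiver_on_diag[OF q, of r] by auto
        moreover have "y \<noteq> r"
          using calculation(1)[OF that(1)] that(4) skew[of x y] quiver_on_diag[OF q, of r] by auto
        ultimately show ?thesis
          using that trans_out[of x y z] by blast
      qed
    qed
    moreover have directed_out: "directed_transitive B {x. B i x > 0}"
    proof (rule directed_transitiveI, unfold mem_Collect_eq)
      fix x y z
      assume that: "B i x > 0" "B i y > 0" "B i z > 0" "B x y > 0" "B y z > 0"
      show "B x z > 0"
      proof -
        have s: "B w r > 0 \<or> B r w > 0" if w: "B i w > 0" for w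
          using side[of w] inside[OF w] ri w skew[of r i] by force
        have no: "\<not> (B u r > 0 \<and> B r w > 0 \<and> B u w > 0)" for u w
          using dom[of u w] skew[of u w] by force
        show ?thesis
          using s[OF that(1)] s[OF that(2)] s[OF that(3)] no[of x y] no[of y z] dom[of z x]
            that(4,5) trans_in[of x y z] trans_out[of x y z] by force
      qed
    qed
    \<comment> \<open>Since \<open>r\<close> points to \<open>i\<close>, domination sends an arrow
      from \<open>i\<close> to every in-neighbour of \<open>r\<close>, in particular to
      \<open>a0\<close>.\<close>
    moreover have "\<exists>b. B i b > 0"
      using dom[OF ab0(1) ri] ab0(1) by (intro exI[of _ a0]) linarith
    ultimately show ?thesis
      using q assms(2) abund ri unfolding opens_fork_def by blast
  next
    \<comment> \<open>The previous case with all arrows reversed.\<close>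
    case ir: 2
    have "B a b + B a i * B i b > B a i \<and> B a b + B a i * B i b > B i b"
      if a: "B a i > 0" and b: "B i b > 0" for a b
    proof (cases "B a b > 0")
      case True
      then show ?thesis using pos a b by blast
    next
      case False
      consider "b = r" | "B b r > 0" | "B r b > 0"
        using side inside[OF b] by blast
      then show ?thesis
      proof cases
        case 1
        have "B r a > 0"
          using 1 False side[of a] inside[OF a] a ir skew[of r i] by force
        then show ?thesis
          using dom[of i a] ir 1 big[of "B i r" "B r a" "B a i"] skew[of r a] inside(4)[OF ir] a
          by (auto simp: mult.commute)
      next
        case 3
        then show ?thesis using dom[of i b] ir b skew[of b i] by auto
      next
        case 2
        have "a \<noteq> r" using a ir skew[of r i] by auto
        then consider "B a r > 0" | "B r a > 0"
          using side[of a] inside[OF a] by blast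
        then have "B a b > 0"
          using dom[of b a] trans_in[of a i b] 2 ir a b by cases auto
        then show ?thesis using False by blast
      qed
    qed
    moreover have directed_out: "directed_transitive B {x. B i x > 0}"
    proof (rule directed_transitiveI, unfold mem_Collect_eq)
      fix x y z
      assume that: "B i x > 0" "B i y > 0" "B i z > 0" "B x y > 0" "B y z > 0"
      show "B x z > 0"
      proof -
        have "w = r \<or> B w r > 0" if w: "B i w > 0" for w
          using side[of w] inside[OF w] dom[of i w] ir w skew[of w i] by force
        moreover have "x \<noteq> r"
          using calculation[OF that(2)] that(4) skew[of x y] quiver_on_diag[OF q, of r] by auto
        moreover have "y \<noteq> r"
          using calculation(1)[OF that(3)] that(5) skew[of z y] quiver_on_diag[OF q, of r] by auto
        ultimately show ?thesis
          using that trans_in[of x y z] by blast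
      qed
    qed
    moreover have directed_in: "directed_transitive B {x. B x i > 0}"
    proof (rule directed_transitiveI, unfold mem_Collect_eq)
      fix x y z
      assume that: "B x i > 0" "B y i > 0" "B z i > 0" "B x y > 0" "B y z > 0"
      show "B x z > 0"
      proof -
        have s: "B w r > 0 \<or> B r w > 0" if w: "B w i > 0" for w
          using side[of w] inside[OF w] ir w skew[of r i] by force
        have no: "\<not> (B u r > 0 \<and> B r w > 0 \<and> B u w > 0)" for u w
          using dom[of u w] skew[of u w] by force
        show ?thesis
          using s[OF that(1)] s[OF that(2)] s[OF that(3)] no[of x y] no[of y z] dom[of z x]
            that(4,5) trans_in[of x y z] trans_out[of x y z] by force
      qed
    qed
    moreover have "\<exists>a. B a i > 0"
      using dom[OF ir ab0(2)] ir by (intro exI[of _ b0]) linarith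
    ultimately show ?thesis
      using q assms(2) abund ir unfolding opens_fork_def by blast
  qed
qed

lemma fork_mutate: "fork n r B \<Longrightarrow> i \<in> {1..n} \<Longrightarrow> i \<noteq> r \<Longrightarrow> fork n i (mutate i B)"
  using fork_mutate_if_opens_fork opens_fork_if_fork by blast

text \<open>Every mutation makes the vertex just mutated the new point of return, so absence of
  backtracking is precisely what the induction needs. Prefixing \<open>r\<close> says that the first
  letter avoids the initial point of return.\<close>

lemma fork_mutate_seq:
  assumes "fork n r B" "set ks \<subseteq> {1..n}" "distinct_adj (r # ks)"
  shows "\<exists>r. fork n r (mutate_seq ks B)"
  using assms
proof (induction ks arbitrary: r B)
  case (Cons k ks)
  then have "fork n k (mutate k B)"
    by (intro fork_mutate[of n r]) auto
  then show ?case
    using Cons by simp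
qed auto

text \<open>An out-neighbour of \<open>r\<close> points to the in-neighbours of \<open>r\<close> by
  domination; for \<open>r\<close> and its in-neighbours an outgoing arrow is at hand.\<close>

lemma fork_no_sink:
  assumes "fork n r B" "i \<in> {1..n}"
  shows "\<exists>j. B i j > 0"
proof -
  note skew = quiver_on_skew[of n B]
  obtain a b where ab: "B a r > 0" "B r b > 0"
    using assms unfolding fork_def by blast
  have dom: "B b a > B a r \<and> B b a > B r b" if "B a r > 0" "B r b > 0" for a b
    using assms(1) that unfolding fork_def by blast
  have "i = r \<or> \<bar>B i r\<bar> \<ge> 2"
    using assms unfolding fork_def by blast
  then consider "i = r" | "B i r > 0" | "B r i > 0"
    using skew[of i r] assms(1) unfolding fork_def by fastforce
  then show ?thesis
  proof cases
    case 3
    then show ?thesis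
      using dom[OF ab(1) 3] by (intro exI[of _ a]) linarith
  qed (use ab in auto)
qed

text \<open>Acyclicity on either side of \<open>i\<close> is certified by a rank in the natural
  numbers. Domination is asked only where \<open>B a b\<close> is not positive: otherwise the
  product of two weights that are at least 2 already wins.\<close>

lemma opens_forkI:
  assumes "quiver_on n B" "i \<in> {1..n}"
    and abund: "\<And>x y. x \<in> {1..n} \<Longrightarrow> y \<in> {1..n} \<Longrightarrow> x \<noteq> y \<Longrightarrow> \<bar>B x y\<bar> \<ge> 2"
    and ex: "B p i > 0" "B i q > 0"
    and dom: "\<And>a b. a \<in> {1..n} \<Longrightarrow> b \<in> {1..n} \<Longrightarrow> B a i > 0 \<Longrightarrow> B i b > 0 \<Longrightarrow> B a b \<le> 0 \<Longrightarrow>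
        B a b + B a i * B i b > B a i \<and> B a b + B a i * B i b > B i b"
    and inn: "\<And>x y. x \<in> {1..n} \<Longrightarrow> y \<in> {1..n} \<Longrightarrow> B x i > 0 \<Longrightarrow> B y i > 0 \<Longrightarrow> (B x y > 0) = (f x < (f y :: nat))"
    and out: "\<And>x y. x \<in> {1..n} \<Longrightarrow> y \<in> {1..n} \<Longrightarrow> B i x > 0 \<Longrightarrow> B i y > 0 \<Longrightarrow> (B x y > 0) = (g x < (g y :: nat))"
  shows "opens_fork n i B"
proof -
  have inside: "x \<in> {1..n} \<and> y \<in> {1..n}" if "B x y > 0" for x y
    using quiver_on_outside[OF assms(1), of x y] that by fastforce
  have "B a b + B a i * B i b > B a i \<and> B a b + B a i * B i b > B i b"
    if "B a i > 0" "B i b > 0" for a b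
  proof (cases "B a b > 0")
    case True
    have "a \<noteq> i" "b \<noteq> i"
      using that quiver_on_diag[OF assms(1), of i] by auto
    then have "B a i \<ge> 2" "B i b \<ge> 2"
      using abund[of a i] abund[of i b] inside[OF that(1)] inside[OF that(2)] that by auto
    then show ?thesis
      using int_mult_gt[of "B a i" "B i b"] True by linarith
  next
    case False
    then show ?thesis
      using dom[of a b] inside[OF that(1)] inside[OF that(2)] that by auto
  qed
  moreover have "directed_transitive B {x. B x i > 0}"
  proof (rule directed_transitiveI, unfold mem_Collect_eq)
    fix x y z
    assume xyz: "B x i > 0" "B y i > 0" "B z i > 0" "B x y > 0" "B y z > 0"
    then have "f x < f y" "f y < f z"
      using inn[of x y] inn[of y z] inside by blast+
    then have "f x < f z" by simp
    then show "B x z > 0"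
      using inn[of x z] xyz inside by blast
  qed
  moreover have "directed_transitive B {x. B i x > 0}"
  proof (rule directed_transitiveI, unfold mem_Collect_eq)
    fix x y z
    assume xyz: "B i x > 0" "B i y > 0" "B i z > 0" "B x y > 0" "B y z > 0"
    then have "g x < g y" "g y < g z"
      using out[of x y] out[of y z] inside by blast+
    then have "g x < g z" by simp
    then show "B x z > 0"
      using out[of x z] xyz inside by blast
  qed
  ultimately show ?thesis
    using assms(1,2) abund ex unfolding opens_fork_def by blast
qed


section \<open>The two rays of the alternating mutations\<close>

text \<open>The rigid part of a quiver along a ray: \<open>c\<close> is the vertex that continues the ray, \<open>d\<close> the one mutated
  just before, and every other vertex \<open>j < n\<close> closes an oriented cycle \<open>c \<rightarrow> d \<rightarrow> j \<rightarrow> c\<close> whose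
  heaviest side is \<open>d \<rightarrow> j\<close>. The three phases below describe the column of the vertex \<open>n\<close>:
  phase 0 at the two end points of the edge labeled \<open>n\<close>, phase 1 for at most two steps starting
  from the quiver with sink \<open>n\<close>, and phase 2 from then on.\<close>

definition spiral :: "nat \<Rightarrow> nat \<Rightarrow> nat \<Rightarrow> quiver \<Rightarrow> bool" where
  "spiral n c d B \<longleftrightarrow> (c = 1 \<and> d = 2 \<or> c = 2 \<and> d = 1) \<and> B c d \<ge> 2 \<and>
     (\<forall>j. 3 \<le> j \<longrightarrow> j < n \<longrightarrow> B j c \<ge> 2 \<and> B d j > B j c \<and> B d j > B c d) \<and>
     (\<forall>i j. 3 \<le> i \<longrightarrow> i < j \<longrightarrow> j < n \<longrightarrow> B i j \<ge> 2)"

definition phase0 :: "nat \<Rightarrow> quiver \<Rightarrow> bool" where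
  "phase0 n B \<longleftrightarrow> (\<forall>i. 1 \<le> i \<longrightarrow> i < n \<longrightarrow> B i n \<ge> 2) \<or> (\<forall>i. 1 \<le> i \<longrightarrow> i < n \<longrightarrow> B i n \<le> - 2)"

definition phase1 :: "nat \<Rightarrow> nat \<Rightarrow> nat \<Rightarrow> quiver \<Rightarrow> bool" where
  "phase1 n c d B \<longleftrightarrow> B d n \<le> - 2 \<and> \<bar>B c n\<bar> \<ge> 2 \<and>
     (\<forall>j. 3 \<le> j \<longrightarrow> j < n \<longrightarrow> B j n \<ge> 2 - B d j * B d n)"

definition phase2 :: "nat \<Rightarrow> nat \<Rightarrow> nat \<Rightarrow> quiver \<Rightarrow> bool" where
  "phase2 n c d B \<longleftrightarrow> B d n \<ge> 2 \<and> B c n + B d n < 0 \<and> B c n + B c d < 0 \<and>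
     ((\<forall>j. 3 \<le> j \<longrightarrow> j < n \<longrightarrow> B j n \<ge> 2) \<or> (\<forall>j. 3 \<le> j \<longrightarrow> j < n \<longrightarrow> B j n \<le> - 2))"

text \<open>The column of \<open>n\<close> does not enter, so the property can be read off from
  \<open>winding\<close>.\<close>

lemma spiral_full_subquiver:
  assumes "n \<ge> 4"
  shows "spiral n c d (full_subquiver (n - 1) B) = spiral n c d B"
proof -
  have "full_subquiver (n - 1) B i j = B i j" if "1 \<le> i" "i < n" "1 \<le> j" "j < n" for i j
    using that by (auto simp: full_subquiver_def)
  then show ?thesis
    using assms unfolding spiral_def by auto
qed

text \<open>This is the direction of winding up, away from \<open>R\<close>; the rays mutate at
  \<open>c\<close> and run the opposite way. The new heaviest side is
  \<open>B c d * B d j - B j c\<close>, which exceeds \<open>B d j\<close> because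
  \<open>B c d\<close> is at least 2 and \<open>B d j > B j c\<close>.\<close>

lemma spiral_mutate:
  assumes "spiral n c d B" "quiver_on m B"
  shows "spiral n d c (mutate d B)"
proof -
  have cd: "c = 1 \<and> d = 2 \<or> c = 2 \<and> d = 1" and b: "B c d \<ge> 2"
    and j: "\<And>j. 3 \<le> j \<Longrightarrow> j < n \<Longrightarrow> B j c \<ge> 2 \<and> B d j > B j c \<and> B d j > B c d"
    and ij: "\<And>i j. 3 \<le> i \<Longrightarrow> i < j \<Longrightarrow> j < n \<Longrightarrow> B i j \<ge> 2"
    using assms(1) unfolding spiral_def by blast+
  note skew = quiver_on_skew[OF assms(2)]
  have "mutate d B d c = B c d"
    using skew[of d c] by (simp add: mutate_apply)
  moreover have "mutate d B j d = B d j" for j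
    using skew[of d j] by (simp add: mutate_apply)
  moreover have "mutate d B c j = B c d * B d j - B j c" if "3 \<le> j" "j < n" for j
    using j[OF that] that b cd skew[of c j] by (auto simp: mutate_apply)
  moreover have "B c d * B d j - B j c > B d j \<and> B c d * B d j - B j c > B c d" if "3 \<le> j" "j < n" for j
    using mult_right_mono[OF b, of "B d j"] j[OF that] b by linarith
  moreover have "mutate d B i j = B i j" if "3 \<le> i" "i < j" "j < n" for i j
    using j[of i] j[of j] that cd skew[of i d] by (auto simp: mutate_apply)
  ultimately show ?thesis
    using cd b j ij unfolding spiral_def by (smt (verit))
qed

text \<open>The first mutation at 2 turns the paths \<open>1 -> 2 -> j\<close> into oriented
  triangles \<open>2 -> 1 -> j -> 2\<close>.\<close>

lemma spiral_start:
  assumes "quiver_on m R" "n \<ge> 4" "\<And>i j. 1 \<le> i \<Longrightarrow> i < j \<Longrightarrow> j < n \<Longrightarrow> R i j \<ge> 2"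
  shows "spiral n 2 1 (mutate 2 R)"
proof -
  note skew = quiver_on_skew[OF assms(1)]
  have b: "R 1 2 \<ge> 2" using assms(2,3) by simp
  have j: "R 1 j \<ge> 2" "R 2 j \<ge> 2" "R j 2 = - R 2 j" if "3 \<le> j" "j < n" for j
    using assms(3) that skew[of j 2] by simp_all
  have "mutate 2 R 2 1 = R 1 2"
    using skew[of 2 1] by (simp add: mutate_apply)
  moreover have "mutate 2 R j 2 = R 2 j" for j
    using skew[of 2 j] by (simp add: mutate_apply)
  moreover have "mutate 2 R 1 j = R 1 j + R 1 2 * R 2 j" if "3 \<le> j" "j < n" for j
    using j[OF that] b that by (auto simp: mutate_apply)
  moreover have "R 1 j + R 1 2 * R 2 j > R 2 j \<and> R 1 j + R 1 2 * R 2 j > R 1 2" if "3 \<le> j" "j < n" for j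
    using int_mult_gt[OF b j(2)[OF that]] j(1)[OF that] by linarith
  moreover have "mutate 2 R i j = R i j" if "3 \<le> i" "i < j" "j < n" for i j
    using j[of i] j[of j] that by (auto simp: mutate_apply)
  ultimately show ?thesis
    using assms(3) b j unfolding spiral_def by auto
qed

section \<open>Wrong turns off a ray open forks\<close>

lemma spiral_abundant:
  assumes "spiral n c d B" "quiver_on n B" "\<And>i. 1 \<le> i \<Longrightarrow> i < n \<Longrightarrow> \<bar>B i n\<bar> \<ge> 2"
    "x \<in> {1..n}" "y \<in> {1..n}" "x \<noteq> y"
  shows "\<bar>B x y\<bar> \<ge> 2"
proof -
  have cd: "c = 1 \<and> d = 2 \<or> c = 2 \<and> d = 1" and b: "B c d \<ge> 2"
    and j: "\<And>j. 3 \<le> j \<Longrightarrow> j < n \<Longrightarrow> B j c \<ge> 2 \<and> B d j > B j c \<and> B d j > B c d"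
    and ij: "\<And>i j. 3 \<le> i \<Longrightarrow> i < j \<Longrightarrow> j < n \<Longrightarrow> B i j \<ge> 2"
    using assms(1) unfolding spiral_def by blast+
  note skew = quiver_on_skew[OF assms(2)]
  have *: "\<bar>B x y\<bar> \<ge> 2" if xy: "1 \<le> x" "x < y" "y \<le> n" for x y
  proof (cases "y = n")
    case True
    then show ?thesis using assms(3)[of x] that by simp
  next
    case False
    have C: "\<bar>B j c\<bar> \<ge> 2" "\<bar>B c j\<bar> \<ge> 2" "\<bar>B d j\<bar> \<ge> 2" "\<bar>B j d\<bar> \<ge> 2" if "3 \<le> j" "j < n" for j
      using j[OF that] skew[of c j] skew[of j d] b by linarith+
    have dc: "\<bar>B d c\<bar> \<ge> 2" "\<bar>B c d\<bar> \<ge> 2"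
      using b skew[of d c] by linarith+
    consider "x = c \<and> y = d \<or> x = d \<and> y = c" | "x = c \<or> x = d" "3 \<le> y" "y < n" | "3 \<le> x" "y < n"
    proof -
      have "x = 1 \<or> x = 2 \<or> 3 \<le> x" "y = 2 \<or> 3 \<le> y" "y < n"
        using xy False by linarith+
      then show ?thesis
        using cd xy(2) by (elim disjE conjE) (simp_all add: that)
    qed
    then show ?thesis
    proof cases
      case 3
      then show ?thesis using ij[of x y] that by simp
    qed (use C dc in auto)
  qed
  show ?thesis
    using *[of x y] *[of y x] skew[of x y] assms(4-6) by (cases x y rule: linorder_cases) auto
qed

text \<open>Here \<open>d\<close> points to \<open>i\<close> and \<open>i\<close> points to
  \<open>c\<close>. The critical pair \<open>d\<close>, \<open>c\<close> is settled by
  \<open>B d i\<close> exceeding both \<open>B c d\<close> and \<open>B i c\<close>. The remaining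
  hypotheses concern \<open>n\<close>: \<open>sgn\<close> places \<open>n\<close> consistently
  relative to the vertices from 3 on, \<open>c'\<close> rules out the pair \<open>n\<close>,
  \<open>c\<close>, and \<open>d\<close> settles the pair \<open>d\<close>,
  \<open>n\<close>.\<close>

lemma spiral_opens_fork_high:
  assumes "spiral n c d B" "quiver_on n B" "n \<ge> 4" "3 \<le> i" "i < n"
    and abund: "\<And>i. 1 \<le> i \<Longrightarrow> i < n \<Longrightarrow> \<bar>B i n\<bar> \<ge> 2"
    and sgn: "(\<forall>j. 3 \<le> j \<longrightarrow> j < n \<longrightarrow> B j n > 0) \<or>
       B d n > 0 \<and> B c n < 0 \<and> (\<forall>j. 3 \<le> j \<longrightarrow> j < n \<longrightarrow> B j n < 0) \<or>
       (\<forall>j. 1 \<le> j \<longrightarrow> j < n \<longrightarrow> B j n < 0)"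
    and d: "B i n > 0 \<Longrightarrow> B d n \<le> 0 \<Longrightarrow> B d n + B d i * B i n > B d i \<and> B d n + B d i * B i n > B i n"
    and c': "B i n < 0 \<Longrightarrow> B c n < 0"
  shows "opens_fork n i B"
proof -
  have cd: "c = 1 \<and> d = 2 \<or> c = 2 \<and> d = 1" and b: "B c d \<ge> 2"
    and j: "\<And>j. 3 \<le> j \<Longrightarrow> j < n \<Longrightarrow> B j c \<ge> 2 \<and> B d j > B j c \<and> B d j > B c d"
    and ij: "\<And>i j. 3 \<le> i \<Longrightarrow> i < j \<Longrightarrow> j < n \<Longrightarrow> B i j \<ge> 2"
    using assms(1) unfolding spiral_def by blast+
  note skew = quiver_on_skew[OF assms(2)]
  note diag = quiver_on_diag[OF assms(2)]
  have cat: "x = c \<or> x = d \<or> x = n \<or> 3 \<le> x \<and> x < n" if "x \<in> {1..n}" for x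
    using that cd by auto
  have neq: "c \<noteq> d" "c \<noteq> n" "d \<noteq> n" "c < 3" "d < 3" "i \<noteq> n" "i \<noteq> c" "i \<noteq> d"
    using cd assms(3-5) by auto
  have C: "B j c > 0" "B c j < 0" "B d j > 0" "B j d < 0" if "3 \<le> j" "j < n" for j
    using j[OF that] skew[of c j] skew[of j d] b by linarith+
  have ij': "B x y > 0 \<longleftrightarrow> x < y" if "3 \<le> x" "x < n" "3 \<le> y" "y < n" for x y
    using ij[of x y] ij[of y x] skew[of x y] diag[of x] that by (cases x y rule: linorder_cases) auto
  have B_in: "x = d \<or> x = n \<and> B n i > 0 \<or> 3 \<le> x \<and> x < i" if "x \<in> {1..n}" "B x i > 0" for x
    using cat[OF that(1)] C[OF assms(4,5)] ij'[of x i] that assms(4,5) by auto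
  have B_out: "x = c \<or> x = n \<and> B i n > 0 \<or> i < x \<and> x < n" if "x \<in> {1..n}" "B i x > 0" for x
    using cat[OF that(1)] C[OF assms(4,5)] ij'[of i x] that assms(4,5) by auto
  \<comment> \<open>Vertices from 3 to \<open>n-1\<close> keep their own number. Among in-neighbours
    of \<open>i\<close>, \<open>n\<close> and \<open>d\<close> come below them, \<open>d\<close> on
    the side of \<open>n\<close> that the sign of \<open>B d n\<close> dictates; among
    out-neighbours \<open>n\<close> and \<open>c\<close> come above them in the same manner.\<close>
  define f where "f = (\<lambda>x. if x = d then (if B d n > 0 then 0 else 2) else if x = n then 1 else x)"
  define g where "g = (\<lambda>x. if x = c then (if B c n > 0 then n else n + 2) else if x = n then n + 1 else x)"
  show ?thesis
  proof (rule opens_forkI[where f = f and g = g])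
    show "quiver_on n B" "i \<in> {1..n}" using assms by auto
    show "B d i > 0" "B i c > 0" using C[OF assms(4,5)] by auto
    show "\<bar>B x y\<bar> \<ge> 2" if "x \<in> {1..n}" "y \<in> {1..n}" "x \<noteq> y" for x y
      using spiral_abundant[OF assms(1,2) abund that] .
    show "(B x y > 0) = (f x < f y)"
      if "x \<in> {1..n}" "y \<in> {1..n}" "B x i > 0" "B y i > 0" for x y
    proof -
      have jn: "B n j > 0 \<and> \<not> B j n > 0" if "3 \<le> j" "j < n" "B n i > 0" for j
      proof -
        have "\<not> B i n > 0" "1 \<le> j"
          using that skew[of n i] by linarith+
        then have "B j n < 0"
          using sgn that(1,2) assms(4,5) by blast
        then show ?thesis
          using skew[of n j] by linarith
      qed
      have dn: "B d n > 0 \<or> B n d > 0" "\<not> (B d n > 0 \<and> B n d > 0)"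
        using abund[of d] cd assms(3) skew[of n d] by auto
      have nd: "\<not> B j d > 0" if "3 \<le> j" "j < n" for j
        using C[OF that] by simp
      have nlt: "\<not> j < 2" "2 < j" "1 < j" "j \<noteq> d" "j \<noteq> n" if "3 \<le> j" "j < n" for j
        using that neq by auto
      have fd: "f d = (if B d n > 0 then 0 else 2)" "f n = 1" and fj: "f j = j" if "3 \<le> j" "j < n" for j
        using neq that by (simp_all add: f_def)
      note fd = fd[OF assms(4,5)]
      have "w = d \<or> w = n \<and> B n i > 0 \<or> 3 \<le> w \<and> w < n" if "w \<in> {1..n}" "B w i > 0" for w
        using B_in[OF that] assms(5) by auto
      note cases_w = this[OF that(1,3)] this[OF that(2,4)]
      have small: "B d n > 0 \<longleftrightarrow> f d < f n" "B n d > 0 \<longleftrightarrow> f n < f d"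
        using dn fd by auto
      have mixed: "B d w > 0 \<longleftrightarrow> f d < f w" "B w d > 0 \<longleftrightarrow> f w < f d" if "3 \<le> w" "w < n" for w
        using C[OF that] nd[OF that] fd fj[OF that] nlt[OF that] by auto
      have mixed': "B n w > 0 \<longleftrightarrow> f n < f w" "B w n > 0 \<longleftrightarrow> f w < f n" if "3 \<le> w" "w < n" "B n i > 0" for w
        using jn[OF that] fd fj[OF that(1,2)] nlt[OF that(1,2)] by auto
      have high: "B x y > 0 \<longleftrightarrow> f x < f y" if "3 \<le> x" "x < n" "3 \<le> y" "y < n"
        using ij'[OF that] fj that by simp
      consider (1) "x = d" "y = d" | (2) "x = d" "y = n" | (3) "x = n" "y = d" | (4) "x = n" "y = n"
        | (5) "x = d" "3 \<le> y" "y < n" | (6) "y = d" "3 \<le> x" "x < n"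
        | (7) "x = n" "3 \<le> y" "y < n" "B n i > 0" | (8) "y = n" "3 \<le> x" "x < n" "B n i > 0"
        | (9) "3 \<le> x" "x < n" "3 \<le> y" "y < n"
        using cases_w by blast
      then show ?thesis
      proof cases
        case 5 then show ?thesis using mixed(1)[of y] by blast
      next
        case 6 then show ?thesis using mixed(2)[of x] by blast
      next
        case 7 then show ?thesis using mixed'(1)[of y] by blast
      next
        case 8 then show ?thesis using mixed'(2)[of x] by blast
      next
        case 9 then show ?thesis using high by blast
      qed (use small diag in simp_all)
    qed
    show "(B x y > 0) = (g x < g y)"
      if "x \<in> {1..n}" "y \<in> {1..n}" "B i x > 0" "B i y > 0" for x y
    proof -
      have jn: "B j n > 0 \<and> \<not> B n j > 0" if "3 \<le> j" "j < n" "B i n > 0" for j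
      proof -
        have "\<not> B i n < 0" "1 \<le> i"
          using that assms(4) by linarith+
        then have "B j n > 0"
          using sgn that(1,2) assms(4,5) by blast
        then show ?thesis
          using skew[of n j] by linarith
      qed
      have cn: "B c n > 0 \<or> B n c > 0" "\<not> (B c n > 0 \<and> B n c > 0)"
        using abund[of c] cd assms(3) skew[of n c] by auto
      have nc: "\<not> B c j > 0" if "3 \<le> j" "j < n" for j
        using C[OF that] by simp
      have gc: "g c = (if B c n > 0 then n else n + 2)" "g n = n + 1" and gj: "g j = j" if "3 \<le> j" "j < n" for j
        using neq that by (simp_all add: g_def)
      note gc = gc[OF assms(4,5)]
      have "w = c \<or> w = n \<and> B i n > 0 \<or> 3 \<le> w \<and> w < n" if "w \<in> {1..n}" "B i w > 0" for w
        using B_out[OF that] assms(4) by auto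
      note cases_w = this[OF that(1,3)] this[OF that(2,4)]
      have small: "B c n > 0 \<longleftrightarrow> g c < g n" "B n c > 0 \<longleftrightarrow> g n < g c"
        using cn gc by auto
      have mixed: "B c w > 0 \<longleftrightarrow> g c < g w" "B w c > 0 \<longleftrightarrow> g w < g c" if "3 \<le> w" "w < n" for w
        using C(1)[OF that] nc[OF that] gc gj[OF that] that(2) by auto
      have mixed': "B n w > 0 \<longleftrightarrow> g n < g w" "B w n > 0 \<longleftrightarrow> g w < g n" if "3 \<le> w" "w < n" "B i n > 0" for w
        using jn[OF that] gc gj[OF that(1,2)] that(2) by auto
      have high: "B x y > 0 \<longleftrightarrow> g x < g y" if "3 \<le> x" "x < n" "3 \<le> y" "y < n"
        using ij'[OF that] gj that by simp
      consider (1) "x = c" "y = c" | (2) "x = c" "y = n" | (3) "x = n" "y = c" | (4) "x = n" "y = n"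
        | (5) "x = c" "3 \<le> y" "y < n" | (6) "y = c" "3 \<le> x" "x < n"
        | (7) "x = n" "3 \<le> y" "y < n" "B i n > 0" | (8) "y = n" "3 \<le> x" "x < n" "B i n > 0"
        | (9) "3 \<le> x" "x < n" "3 \<le> y" "y < n"
        using cases_w by blast
      then show ?thesis
      proof cases
        case 5 then show ?thesis using mixed(1)[of y] by blast
      next
        case 6 then show ?thesis using mixed(2)[of x] by blast
      next
        case 7 then show ?thesis using mixed'(1)[of y] by blast
      next
        case 8 then show ?thesis using mixed'(2)[of x] by blast
      next
        case 9 then show ?thesis using high by blast
      qed (use small diag in simp_all)
    qed
    show "B a b' + B a i * B i b' > B a i \<and> B a b' + B a i * B i b' > B i b'"
      if h: "a \<in> {1..n}" "b' \<in> {1..n}" "B a i > 0" "B i b' > 0" "B a b' \<le> 0" for a b'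
    proof -
      have nn: "\<not> (B n i > 0 \<and> B i n > 0)" using skew[of n i] by auto
      have cn: "B n i > 0 \<Longrightarrow> B n c > 0"
        using c' skew[of n i] skew[of n c] by auto
      have nj: "B n i > 0 \<Longrightarrow> 3 \<le> j \<Longrightarrow> j < n \<Longrightarrow> B n j > 0" for j
        using sgn skew[of n i] skew[of n j] assms(4,5) by auto
      have jn: "B j n > 0" if "B i n > 0" "3 \<le> j" "j < n" for j
      proof -
        have "\<not> B i n < 0" "1 \<le> i"
          using that assms(4) by linarith+
        then show ?thesis
          using sgn that assms(4,5) by blast
      qed
      \<comment> \<open>All other pairs have an arrow from \<open>a\<close> to \<open>b'\<close>, so
        they are excluded by \<open>h(5)\<close>.\<close>
      consider "a = d" "b' = c" | "a = d" "b' = n" "B i n > 0"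
        using B_in[OF h(1,3)] B_out[OF h(2,4)] h(5) C[of a] C[of b'] ij'[of a b']
          nn cn nj[of b'] jn[of a] assms(4,5) by auto
      then show ?thesis
      proof cases
        case 1
        have "B d i * B i c \<ge> B d i * 2"
          using j[OF assms(4,5)] b by (intro mult_left_mono) auto
        then show ?thesis
          using j[OF assms(4,5)] skew[of d c] unfolding 1 by linarith
      next
        case 2
        then show ?thesis using d h(5) by auto
      qed
    qed
  qed
qed

text \<open>In phase 1 the critical pairs are \<open>x\<close>, \<open>d\<close> with
  \<open>x\<close> from 3 on, and the column entry \<open>B x n\<close> outweighs
  \<open>B d x\<close>. In phase 2 the only critical pair is \<open>d\<close>, \<open>c\<close>, and
  \<open>B n c\<close> outweighs both \<open>B c d\<close> and \<open>B d n\<close>.\<close>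

lemma spiral_opens_fork_top:
  assumes "spiral n c d B" "quiver_on n B" "n \<ge> 4"
    and abund: "\<And>i. 1 \<le> i \<Longrightarrow> i < n \<Longrightarrow> \<bar>B i n\<bar> \<ge> 2"
    and "phase1 n c d B \<or> phase2 n c d B"
  shows "opens_fork n n B"
proof -
  have cd: "c = 1 \<and> d = 2 \<or> c = 2 \<and> d = 1" and b: "B c d \<ge> 2"
    and j: "\<And>j. 3 \<le> j \<Longrightarrow> j < n \<Longrightarrow> B j c \<ge> 2 \<and> B d j > B j c \<and> B d j > B c d"
    and ij: "\<And>i j. 3 \<le> i \<Longrightarrow> i < j \<Longrightarrow> j < n \<Longrightarrow> B i j \<ge> 2"
    using assms(1) unfolding spiral_def by blast+
  note skew = quiver_on_skew[OF assms(2)]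
  note diag = quiver_on_diag[OF assms(2)]
  have cat: "x = c \<or> x = d \<or> x = n \<or> 3 \<le> x \<and> x < n" if "x \<in> {1..n}" for x
    using that cd by auto
  have neq: "c \<noteq> d" "c \<noteq> n" "d \<noteq> n" "c < 3" "d < 3" "c < n" "d < n"
    using cd assms(3) by auto
  have C: "B j c > 0" "B c j < 0" "B d j > 0" "B j d < 0" if "3 \<le> j" "j < n" for j
    using j[OF that] skew[of c j] skew[of j d] b by linarith+
  have dc: "B d c < 0" using skew[of d c] b by simp
  have ij': "B x y > 0 \<longleftrightarrow> x < y" if "3 \<le> x" "x < n" "3 \<le> y" "y < n" for x y
    using ij[of x y] ij[of y x] skew[of x y] diag[of x] that by (cases x y rule: linorder_cases) auto
  have ab: "\<bar>B x y\<bar> \<ge> 2" if "x \<in> {1..n}" "y \<in> {1..n}" "x \<noteq> y" for x y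
    using spiral_abundant[OF assms(1,2) abund that] .
  \<comment> \<open>Without the arrow from \<open>c\<close> to \<open>d\<close> the order is
    \<open>d\<close>, then the vertices from 3 on, then \<open>c\<close>. That arrow runs against
    it, so the rank serves only for sets that do not contain both.\<close>
  define f where "f = (\<lambda>x. if x = c then n else if x = d then 0 else x)"
  have rank: "(B x y > 0) = (f x < f y)"
    if "x \<in> {1..n}" "y \<in> {1..n}" "x \<noteq> n" "y \<noteq> n" "\<not> (x = c \<and> y = d)" "\<not> (x = d \<and> y = c)" for x y
  proof -
    have nc: "\<not> B c j > 0" "\<not> B j d > 0" if "3 \<le> j" "j < n" for j
      using C[OF that] by simp_all
    from cat[OF that(1)] cat[OF that(2)] show ?thesis
      by (elim disjE conjE)
        (use that(3-6) C[of x] C[of y] nc[of x] nc[of y] ij'[of x y] neq diag in \<open>simp_all add: f_def\<close>)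
  qed
  show ?thesis
    using assms(5)
  proof
    assume p: "phase1 n c d B"
    have jn: "B j n \<ge> 2 - B d j * B d n" if "3 \<le> j" "j < n" for j
      using p that unfolding phase1_def by auto
    have dn: "B d n \<le> -2" using p unfolding phase1_def by auto
    have jn': "B j n > B d j" "B j n > B n d" "B j n > 0" if "3 \<le> j" "j < n" for j
    proof -
      have "3 \<le> B d j" using j[OF that] by linarith
      then have "- (B d j * B d n) \<ge> B d j" "- (B d j * B d n) \<ge> - B d n"
        using mult_left_mono[of 2 "- B d n" "B d j"] mult_right_mono[of 3 "B d j" "- B d n"] dn by auto
      then show "B j n > B d j" "B j n > B n d" "B j n > 0"
        using jn[OF that] skew[of n d] \<open>3 \<le> B d j\<close> by linarith+
    qed
    \<comment> \<open>Out-neighbours of \<open>n\<close> are now among \<open>c\<close> and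
      \<open>d\<close>, possibly both, so this side is ranked by the arrow from \<open>c\<close> to
      \<open>d\<close>.\<close>
    show ?thesis
    proof (rule opens_forkI[where f = f and g = "\<lambda>x. if x = c then 0 else 1"])
      show "quiver_on n B" "n \<in> {1..n}" using assms by auto
      show "B 3 n > 0" "B n d > 0" using jn'[of 3] skew[of n d] dn assms(3) by auto
      show "\<bar>B x y\<bar> \<ge> 2" if "x \<in> {1..n}" "y \<in> {1..n}" "x \<noteq> y" for x y
        using ab[OF that] .
      show "(B x y > 0) = (f x < f y)"
        if "x \<in> {1..n}" "y \<in> {1..n}" "B x n > 0" "B y n > 0" for x y
      proof -
        have "x \<noteq> d" "y \<noteq> d" "x \<noteq> n" "y \<noteq> n" using that dn diag by auto
        then show ?thesis using rank[of x y] that by auto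
      qed
      have out: "x = c \<or> x = d" if "x \<in> {1..n}" "B n x > 0" for x
        using cat[OF that(1)] that jn'[of x] skew[of n x] diag[of n] by auto
      show "(B x y > 0) = ((if x = c then 0 else 1 :: nat) < (if y = c then 0 else 1))"
        if "x \<in> {1..n}" "y \<in> {1..n}" "B n x > 0" "B n y > 0" for x y
        using out[OF that(1,3)] out[OF that(2,4)] b dc diag[of x] neq by auto
      show "B x y + B x n * B n y > B x n \<and> B x y + B x n * B n y > B n y"
        if "x \<in> {1..n}" "y \<in> {1..n}" "B x n > 0" "B n y > 0" "B x y \<le> 0" for x y
      proof -
        have cc: "\<not> (B c n > 0 \<and> B n c > 0)" using skew[of n c] by auto
        have xy: "y = d" "3 \<le> x" "x < n"
          using cat[OF that(1)] out[OF that(2,4)] that dn C[of x] b diag[of n] cc by auto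
        have "B x n * B n d \<ge> 2 * B x n"
          using mult_left_mono[of 2 "B n d" "B x n"] skew[of n d] dn that by auto
        then show ?thesis
          using jn'[OF xy(2,3)] skew[of x d] unfolding xy(1) by linarith
      qed
    qed
  next
    assume p: "phase2 n c d B"
    have dn: "B d n \<ge> 2" and cn: "B c n + B d n < 0" "B c n + B c d < 0"
      and jn: "(\<forall>j. 3 \<le> j \<longrightarrow> j < n \<longrightarrow> B j n \<ge> 2) \<or> (\<forall>j. 3 \<le> j \<longrightarrow> j < n \<longrightarrow> B j n \<le> - 2)"
      using p unfolding phase2_def by auto
    show ?thesis
    proof (rule opens_forkI[where f = f and g = f])
      show "quiver_on n B" "n \<in> {1..n}" using assms by auto
      show "B d n > 0" "B n c > 0" using dn cn skew[of n c] by auto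
      show "\<bar>B x y\<bar> \<ge> 2" if "x \<in> {1..n}" "y \<in> {1..n}" "x \<noteq> y" for x y
        using ab[OF that] .
      show "(B x y > 0) = (f x < f y)"
        if "x \<in> {1..n}" "y \<in> {1..n}" "B x n > 0" "B y n > 0" for x y
      proof -
        have "x \<noteq> c" "y \<noteq> c" "x \<noteq> n" "y \<noteq> n" using that dn cn diag by auto
        then show ?thesis using rank[of x y] that by auto
      qed
      show "(B x y > 0) = (f x < f y)"
        if "x \<in> {1..n}" "y \<in> {1..n}" "B n x > 0" "B n y > 0" for x y
      proof -
        have "x \<noteq> d" "y \<noteq> d" "x \<noteq> n" "y \<noteq> n" using that dn skew[of n d] diag by auto
        then show ?thesis using rank[of x y] that by auto
      qed
      show "B x y + B x n * B n y > B x n \<and> B x y + B x n * B n y > B n y"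
        if "x \<in> {1..n}" "y \<in> {1..n}" "B x n > 0" "B n y > 0" "B x y \<le> 0" for x y
      proof -
        have nd: "\<not> B n d > 0" using dn skew[of n d] by auto
        have jj: "\<not> (B x n > 0 \<and> B n y > 0 \<and> 3 \<le> x \<and> x < n \<and> 3 \<le> y \<and> y < n)"
          using jn skew[of n y] by fastforce
        have xy: "x = d" "y = c"
          using cat[OF that(1)] cat[OF that(2)] that dn cn C[of x] C[of y] diag[of n] jj nd by auto
        have "B d n * B n c \<ge> 2 * B n c"
          using mult_right_mono[of 2 "B d n" "B n c"] dn that xy by auto
        then show ?thesis
          using xy skew[of n c] skew[of d c] cn by simp
      qed
    qed
  qed
qed

lemma phase_abundant:
  assumes "spiral n c d B" "n \<ge> 4" "phase0 n B \<or> phase1 n c d B \<or> phase2 n c d B" "1 \<le> i" "i < n"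
  shows "\<bar>B i n\<bar> \<ge> 2"
proof -
  have cd: "c = 1 \<and> d = 2 \<or> c = 2 \<and> d = 1" and b: "B c d \<ge> 2"
    and j: "\<And>j. 3 \<le> j \<Longrightarrow> j < n \<Longrightarrow> B j c \<ge> 2 \<and> B d j > B j c \<and> B d j > B c d"
    using assms(1) unfolding spiral_def by blast+
  consider "i = c" | "i = d" | "3 \<le> i"
    using cd assms(4) by fastforce
  then show ?thesis
  proof cases
    case 1
    then show ?thesis
      using assms(3-5) b unfolding phase0_def phase1_def phase2_def by force
  next
    case 2
    then show ?thesis
      using assms(3-5) b unfolding phase0_def phase1_def phase2_def by force
  next
    case 3
    have "B i n \<ge> 2" if p: "phase1 n c d B"
    proof -
      have "B i n \<ge> 2 - B d i * B d n" "B d n \<le> 0"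
        using p 3 assms(5) unfolding phase1_def by auto
      moreover have "B d i * B d n \<le> 0"
        using j[OF 3 assms(5)] \<open>B d n \<le> 0\<close> by (intro mult_nonneg_nonpos) auto
      ultimately show ?thesis by linarith
    qed
    moreover have "B i n \<ge> 2 \<or> B i n \<le> -2" if "phase0 n B \<or> phase2 n c d B"
      using that 3 assms(4,5) unfolding phase0_def phase2_def by blast
    ultimately show ?thesis
      using assms(3) by force
  qed
qed

text \<open>Needed only at the two end points of the edge \<open>n\<close>: later on the ray
  \<open>d\<close> is the letter just used. As the column of \<open>n\<close> has a constant sign,
  the critical pairs are \<open>c\<close>, \<open>j\<close> with \<open>j\<close> from 3 on, where
  \<open>B c d * B d j\<close> is at least \<open>2 * B d j\<close>.\<close>

lemma spiral_opens_fork_second: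
  assumes "spiral n c d B" "quiver_on n B" "n \<ge> 4" "phase0 n B"
  shows "opens_fork n d B"
proof -
  have cd: "c = 1 \<and> d = 2 \<or> c = 2 \<and> d = 1" and b: "B c d \<ge> 2"
    and j: "\<And>j. 3 \<le> j \<Longrightarrow> j < n \<Longrightarrow> B j c \<ge> 2 \<and> B d j > B j c \<and> B d j > B c d"
    and ij: "\<And>i j. 3 \<le> i \<Longrightarrow> i < j \<Longrightarrow> j < n \<Longrightarrow> B i j \<ge> 2"
    using assms(1) unfolding spiral_def by blast+
  note skew = quiver_on_skew[OF assms(2)]
  note diag = quiver_on_diag[OF assms(2)]
  have cat: "x = c \<or> x = d \<or> x = n \<or> 3 \<le> x \<and> x < n" if "x \<in> {1..n}" for x
    using that cd by auto
  have C: "B j c > 0" "\<not> B c j > 0" "B d j > 0" "\<not> B j d > 0" if "3 \<le> j" "j < n" for j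
    using j[OF that] skew[of c j] skew[of j d] b by linarith+
  have dc: "\<not> B d c > 0" using skew[of d c] b by simp
  have ij': "B x y > 0 \<longleftrightarrow> x < y" if "3 \<le> x" "x < n" "3 \<le> y" "y < n" for x y
    using ij[of x y] ij[of y x] skew[of x y] diag[of x] that by (cases x y rule: linorder_cases) auto
  have neq: "c \<noteq> d" "c \<noteq> n" "d \<noteq> n" "c < 3" "d < 3" "c < n" "d < n" "1 \<le> c" "1 \<le> d"
    using cd assms(3) by auto
  have sgn: "(\<forall>i. 1 \<le> i \<longrightarrow> i < n \<longrightarrow> B i n > 0 \<and> \<not> B n i > 0) \<or> (\<forall>i. 1 \<le> i \<longrightarrow> i < n \<longrightarrow> B n i > 0 \<and> \<not> B i n > 0)"
    using assms(4) unfolding phase0_def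
  proof
    assume *: "\<forall>i\<ge>1. i < n \<longrightarrow> 2 \<le> B i n"
    have "B i n > 0 \<and> \<not> B n i > 0" if "1 \<le> i" "i < n" for i
      using * that skew[of n i] by force
    then show ?thesis by blast
  next
    assume *: "\<forall>i\<ge>1. i < n \<longrightarrow> B i n \<le> - 2"
    have "B n i > 0 \<and> \<not> B i n > 0" if "1 \<le> i" "i < n" for i
      using * that skew[of n i] by force
    then show ?thesis by blast
  qed
  have B_in: "x = c \<or> x = n \<and> B n d > 0" if "x \<in> {1..n}" "B x d > 0" for x
    using cat[OF that(1)] C(4)[of x] that(2) diag[of d] by auto
  have B_out: "x = n \<and> B d n > 0 \<or> 3 \<le> x \<and> x < n" if "x \<in> {1..n}" "B d x > 0" for x
    using cat[OF that(1)] that(2) diag[of d] dc by auto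
  have nc: "B n c > 0 \<and> \<not> B c n > 0" if "B n d > 0"
    using sgn that neq by blast
  have nj: "B n j > 0 \<and> \<not> B j n > 0" if "B n d > 0" "3 \<le> j" "j < n" for j
  proof -
    have "1 \<le> j" using that by simp
    then show ?thesis using sgn that neq by blast
  qed
  have jn: "B j n > 0 \<and> \<not> B n j > 0" if "B d n > 0" "3 \<le> j" "j < n" for j
  proof -
    have "1 \<le> j" using that by simp
    then show ?thesis using sgn that neq by blast
  qed
  show ?thesis
  proof (rule opens_forkI[where f = "\<lambda>x. if x = n then 0 else 1" and g = "\<lambda>x. x"])
    show "quiver_on n B" "d \<in> {1..n}" using assms neq by auto
    show "B c d > 0" "B d 3 > 0" using b C(3)[of 3] assms(3) by auto
    show "\<bar>B x y\<bar> \<ge> 2" if "x \<in> {1..n}" "y \<in> {1..n}" "x \<noteq> y" for x y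
      using spiral_abundant[OF assms(1,2) phase_abundant[OF assms(1,3)] that] assms(4) by blast
    show "(B x y > 0) = ((if x = n then 0 else 1 :: nat) < (if y = n then 0 else 1))"
      if "x \<in> {1..n}" "y \<in> {1..n}" "B x d > 0" "B y d > 0" for x y
      using B_in[OF that(1,3)] B_in[OF that(2,4)] nc diag neq by auto
    show "(B x y > 0) = (x < y)"
      if h: "x \<in> {1..n}" "y \<in> {1..n}" "B d x > 0" "B d y > 0" for x y
    proof -
      consider "x = n" "y = n" | "x = n" "B d n > 0" "3 \<le> y" "y < n" | "y = n" "B d n > 0" "3 \<le> x" "x < n"
        | "3 \<le> x" "x < n" "3 \<le> y" "y < n"
        using B_out[OF h(1,3)] B_out[OF h(2,4)] by blast
      then show ?thesis
      proof cases
        case 2 then show ?thesis using jn[of y] by simp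
      next
        case 3 then show ?thesis using jn[of x] by simp
      next
        case 4 then show ?thesis using ij' by blast
      qed (simp add: diag)
    qed
    show "B x y + B x d * B d y > B x d \<and> B x y + B x d * B d y > B d y"
      if "x \<in> {1..n}" "y \<in> {1..n}" "B x d > 0" "B d y > 0" "B x y \<le> 0" for x y
    proof -
      have "\<not> (B d n > 0 \<and> B n d > 0)" "B d n > 0 \<Longrightarrow> B c n > 0"
        using sgn neq by blast+
      then have xy: "x = c" "3 \<le> y" "y < n"
        using B_in[OF that(1,3)] B_out[OF that(2,4)] that(5) nj[of y] by auto
      have "B c d * B d y \<ge> 2 * B d y"
        using mult_right_mono[OF b, of "B d y"] that(4) by simp
      then show ?thesis
        using j[OF xy(2,3)] skew[of y c] unfolding xy(1) by linarith
    qed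
  qed
qed

text \<open>The two exceptions are the letter \<open>c\<close> that continues the ray and the letter
  \<open>d\<close> that would backtrack.\<close>

lemma ray_opens_fork:
  assumes "spiral n c d B" "quiver_on n B" "n \<ge> 4" "phase1 n c d B \<or> phase2 n c d B"
    and "i \<in> {1..n}" "i \<noteq> c" "i \<noteq> d"
  shows "opens_fork n i B"
proof -
  have cd: "c = 1 \<and> d = 2 \<or> c = 2 \<and> d = 1"
    and j: "\<And>j. 3 \<le> j \<Longrightarrow> j < n \<Longrightarrow> B j c \<ge> 2 \<and> B d j > B j c \<and> B d j > B c d" and b: "B c d \<ge> 2"
    using assms(1) unfolding spiral_def by blast+
  have ab: "\<bar>B i n\<bar> \<ge> 2" if "1 \<le> i" "i < n" for i
    using phase_abundant[OF assms(1,3)] assms(4) that by blast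
  show ?thesis
  proof (cases "i = n")
    case True
    then show ?thesis
      using spiral_opens_fork_top[OF assms(1-3) ab assms(4)] by simp
  next
    case False
    then have i: "3 \<le> i" "i < n" using assms(5-7) cd by auto
    have pos: "B j n > 0" if "phase1 n c d B" "3 \<le> j" "j < n" for j
    proof -
      have "B j n \<ge> 2 - B d j * B d n" "B d n \<le> 0"
        using that unfolding phase1_def by auto
      moreover have "B d j * B d n \<le> 0"
        using j[OF that(2,3)] \<open>B d n \<le> 0\<close> by (intro mult_nonneg_nonpos) auto
      ultimately show ?thesis by linarith
    qed
    show ?thesis
    proof (rule spiral_opens_fork_high[OF assms(1-3) i ab])
      show "(\<forall>j. 3 \<le> j \<longrightarrow> j < n \<longrightarrow> B j n > 0) \<or>
       B d n > 0 \<and> B c n < 0 \<and> (\<forall>j. 3 \<le> j \<longrightarrow> j < n \<longrightarrow> B j n < 0) \<or>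
       (\<forall>j. 1 \<le> j \<longrightarrow> j < n \<longrightarrow> B j n < 0)"
        using assms(4)
      proof
        assume p: "phase2 n c d B"
        then have "B d n > 0 \<and> B c n < 0" unfolding phase2_def by auto
        moreover have "(\<forall>j. 3 \<le> j \<longrightarrow> j < n \<longrightarrow> B j n > 0) \<or> (\<forall>j. 3 \<le> j \<longrightarrow> j < n \<longrightarrow> B j n < 0)"
          using p unfolding phase2_def by fastforce
        ultimately show ?thesis by blast
      qed (use pos in blast)
      show "B c n < 0" if "B i n < 0"
        using assms(4) pos[OF _ i] that unfolding phase2_def by force
      show "B d n + B d i * B i n > B d i \<and> B d n + B d i * B i n > B i n" if "B i n > 0" "B d n \<le> 0"
      proof -
        have p: "phase1 n c d B"
          using assms(4) that unfolding phase2_def by auto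
        then have v: "B i n \<ge> 2 - B d i * B d n" "B d n \<le> -2"
          using i unfolding phase1_def by auto
        \<comment> \<open>The 3 comes from \<open>B d i > B c d\<close> and \<open>B c d\<close>
          being at least 2. The phase 1 bound then makes \<open>B i n\<close> larger than both
          \<open>2 * B d i\<close> and three times the size of \<open>B d n\<close>.\<close>
        have x: "3 \<le> B d i" using j[OF i] b by linarith
        have "- (B d i * B d n) \<ge> 3 * (- B d n)"
          using mult_right_mono[OF x, of "- B d n"] v(2) by simp
        moreover have "- (B d i * B d n) \<ge> 2 * B d i"
          using mult_left_mono[of 2 "- B d n" "B d i"] v(2) x by simp
        moreover have "B d i * B i n \<ge> 3 * B i n"
          using mult_right_mono[OF x, of "B i n"] that by simp
        ultimately show ?thesis
          using v x by linarith
      qed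
    qed
  qed
qed

text \<open>Here the exceptions are the next letter \<open>c\<close> and the edge \<open>n\<close>
  itself. With a column of constant sign, the condition on the pair \<open>d\<close>,
  \<open>n\<close> is vacuous.\<close>

lemma start_opens_fork:
  assumes "spiral n c d B" "quiver_on n B" "n \<ge> 4" "phase0 n B" "i \<in> {1..n}" "i \<noteq> c" "i \<noteq> n"
  shows "opens_fork n i B"
proof (cases "i = d")
  case True
  then show ?thesis using spiral_opens_fork_second assms by blast
next
  case False
  have cd: "c = 1 \<and> d = 2 \<or> c = 2 \<and> d = 1"
    using assms(1) unfolding spiral_def by blast
  have i: "3 \<le> i" "i < n" using assms(5-7) False cd by auto
  have cd': "1 \<le> c" "c < n" "1 \<le> d" "d < n" using cd assms(3) by auto
  have sgn: "(\<forall>i. 1 \<le> i \<longrightarrow> i < n \<longrightarrow> B i n > 0) \<or> (\<forall>i. 1 \<le> i \<longrightarrow> i < n \<longrightarrow> B i n < 0)"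
    using assms(4) unfolding phase0_def by fastforce
  show ?thesis
  proof (rule spiral_opens_fork_high[OF assms(1-3) i])
    show "\<bar>B i n\<bar> \<ge> 2" if "1 \<le> i" "i < n" for i
      using phase_abundant[OF assms(1,3)] assms(4) that by blast
    show "(\<forall>j. 3 \<le> j \<longrightarrow> j < n \<longrightarrow> B j n > 0) \<or>
       B d n > 0 \<and> B c n < 0 \<and> (\<forall>j. 3 \<le> j \<longrightarrow> j < n \<longrightarrow> B j n < 0) \<or>
       (\<forall>j. 1 \<le> j \<longrightarrow> j < n \<longrightarrow> B j n < 0)"
      using sgn by fastforce
    have i1: "1 \<le> i" using i by simp
    show "B c n < 0" if "B i n < 0"
      using sgn that i(2) i1 cd' by (metis not_less_iff_gr_or_eq)
    show "B d n + B d i * B i n > B d i \<and> B d n + B d i * B i n > B i n" if "B i n > 0" "B d n \<le> 0"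
      using sgn that i(2) i1 cd' by (metis not_less_iff_gr_or_eq not_less)
  qed
qed

section \<open>The column of \<open>n\<close> along a ray\<close>

lemma mutate_column:
  assumes "quiver_on n B" "B c d > 0" "c \<noteq> n" "d \<noteq> n"
  shows "mutate c B c n = - B c n" "mutate c B c j = B j c" "mutate c B d c = B c d"
    "B c n > 0 \<Longrightarrow> mutate c B d n = B d n"
    "B c n < 0 \<Longrightarrow> mutate c B d n = B d n + B c d * B c n"
    "B c n > 0 \<Longrightarrow> B j c > 0 \<Longrightarrow> j \<noteq> n \<Longrightarrow> mutate c B j n = B j n + B j c * B c n"
    "B c n < 0 \<Longrightarrow> B j c > 0 \<Longrightarrow> mutate c B j n = B j n"
proof -
  note skew = quiver_on_skew[OF assms(1)]
  have dc: "B d c = - B c d" by (rule skew)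
  have cc: "B c c = 0" by (rule quiver_on_diag[OF assms(1)])
  show "mutate c B c n = - B c n" "mutate c B c j = B j c" "mutate c B d c = B c d"
    using skew[of c j] dc by (auto simp: mutate_apply)
  show "B c n > 0 \<Longrightarrow> mutate c B d n = B d n" "B c n < 0 \<Longrightarrow> mutate c B d n = B d n + B c d * B c n"
    using dc cc assms by (auto simp: mutate_apply)
  show "B c n > 0 \<Longrightarrow> B j c > 0 \<Longrightarrow> j \<noteq> n \<Longrightarrow> mutate c B j n = B j n + B j c * B c n"
    "B c n < 0 \<Longrightarrow> B j c > 0 \<Longrightarrow> mutate c B j n = B j n"
    using cc assms by (auto simp: mutate_apply)
qed

lemma phase_mutate:
  assumes "spiral n c d B" "quiver_on n B" "n \<ge> 4" "phase0 n B \<or> phase1 n c d B \<or> phase2 n c d B"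
  shows "phase1 n d c (mutate c B) \<or> phase2 n d c (mutate c B)"
proof -
  have cd: "c = 1 \<and> d = 2 \<or> c = 2 \<and> d = 1" and b: "B c d \<ge> 2"
    and j: "\<And>j. 3 \<le> j \<Longrightarrow> j < n \<Longrightarrow> B j c \<ge> 2 \<and> B d j > B j c \<and> B d j > B c d"
    using assms(1) unfolding spiral_def by blast+
  have neq: "c \<noteq> n" "d \<noteq> n" "1 \<le> c" "c < n" "1 \<le> d" "d < n" using cd assms(3) by auto
  have b0: "B c d > 0" using b by simp
  note m = mutate_column[OF assms(2) b0 neq(1,2)]
  \<comment> \<open>This step explains the bound in \<open>phase1\<close>: entry \<open>j\<close>
    gains \<open>B j c * B c n\<close>, which in the new quiver reads as minus the product of the
    entries \<open>(c,j)\<close> and \<open>(c,n)\<close>, while the old entry contributes at least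
    2.\<close>
  have to1: "phase1 n d c (mutate c B)"
    if "B c n \<ge> 2" "\<bar>B d n\<bar> \<ge> 2" and jn: "\<And>j. 3 \<le> j \<Longrightarrow> j < n \<Longrightarrow> B j n \<ge> 2"
  proof -
    have "mutate c B j n \<ge> 2 - mutate c B c j * mutate c B c n" if "3 \<le> j" "j < n" for j
      using m(1) m(2)[of j] m(6)[of j] jn[OF that] j[OF that] \<open>B c n \<ge> 2\<close> that by simp
    then show ?thesis
      using m(1,4) that(1,2) unfolding phase1_def by simp
  qed
  \<comment> \<open>The first alternative for \<open>dn\<close> is supplied by phase 2, the second
    by the end point with source \<open>n\<close> and by the end of phase 1.\<close>
  have to2: "phase2 n d c (mutate c B)"
    if "B c n \<le> -2" and dn: "B d n + B c n < 0 \<and> B c n \<le> -3 \<or> B d n \<le> -2"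
      and jn: "(\<forall>j. 3 \<le> j \<longrightarrow> j < n \<longrightarrow> B j n \<ge> 2) \<or> (\<forall>j. 3 \<le> j \<longrightarrow> j < n \<longrightarrow> B j n \<le> - 2)"
  proof -
    have "mutate c B j n = B j n" if "3 \<le> j" "j < n" for j
      using m(7)[of j] j[OF that] \<open>B c n \<le> -2\<close> by simp
    then have "(\<forall>j. 3 \<le> j \<longrightarrow> j < n \<longrightarrow> mutate c B j n \<ge> 2) \<or> (\<forall>j. 3 \<le> j \<longrightarrow> j < n \<longrightarrow> mutate c B j n \<le> - 2)"
      using jn by auto
    moreover have p: "B c d * B c n \<le> 2 * B c n" "B c d * B c n \<le> B c d * -2"
      using mult_right_mono_neg[OF b, of "B c n"] mult_left_mono[of "B c n" "-2" "B c d"] b that(1) by auto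
    have q: "B d n + B c d * B c n + B c d < 0" if a: "B d n + B c n < 0" "B c n \<le> -3"
    proof -
      have "(B c d - 1) * B c n \<le> (B c d - 1) * -3"
        using mult_left_mono[OF a(2), of "B c d - 1"] b by simp
      then have "B c d * B c n - B c n \<le> 3 - 3 * B c d"
        by (simp add: algebra_simps)
      then show ?thesis
        using a b by linarith
    qed
    have "B d n + B c d * B c n - B c n < 0" "B d n + B c d * B c n + B c d < 0"
      using dn p q b that(1) by linarith+
    ultimately show ?thesis
      using m(1,3,5) that(1) unfolding phase2_def by simp
  qed
  from assms(4) show ?thesis
  proof (elim disjE)
    assume p: "phase0 n B"
    then consider "\<forall>i. 1 \<le> i \<longrightarrow> i < n \<longrightarrow> B i n \<ge> 2" | "\<forall>i. 1 \<le> i \<longrightarrow> i < n \<longrightarrow> B i n \<le> - 2"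
      unfolding phase0_def by blast
    then show ?thesis
    proof cases
      case 1
      then have "B c n \<ge> 2" "\<bar>B d n\<bar> \<ge> 2" using neq by fastforce+
      then show ?thesis using to1 1 by simp
    next
      case 2
      then have "B c n \<le> -2" "B d n \<le> -2" using neq by fastforce+
      then show ?thesis using to2 2 by simp
    qed
  next
    assume p: "phase1 n c d B"
    have dn: "B d n \<le> -2" "\<bar>B c n\<bar> \<ge> 2" using p unfolding phase1_def by auto
    have jn: "B j n \<ge> 2" if "3 \<le> j" "j < n" for j
    proof -
      have "B j n \<ge> 2 - B d j * B d n"
        using p that unfolding phase1_def by auto
      moreover have "B d j * B d n \<le> 0"
        using j[OF that] dn(1) b by (intro mult_nonneg_nonpos) auto
      ultimately show ?thesis by linarith
    qed
    show ?thesis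
    proof (cases "B c n \<ge> 2")
      case True
      then show ?thesis using to1 dn jn by simp
    next
      case False
      then have "B c n \<le> -2" using dn(2) by linarith
      then show ?thesis using to2 dn jn by simp
    qed
  next
    assume p: "phase2 n c d B"
    \<comment> \<open>The bound -3 is integrality: \<open>B d n\<close> is at least 2 and the sum is
      negative.\<close>
    then have "B d n + B c n < 0 \<and> B c n \<le> -3" unfolding phase2_def by auto
    then show ?thesis
      using to2 p unfolding phase2_def by simp
  qed
qed

section \<open>Alternating words and winding up an acyclic quiver\<close>

fun alternating :: "nat \<Rightarrow> nat \<Rightarrow> nat \<Rightarrow> nat list" where
  "alternating c d 0 = []"
| "alternating c d (Suc t) = c # alternating d c t"

lemma length_alternating [simp]: "length (alternating c d t) = t"
  by (induction t arbitrary: c d) auto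

lemma nth_alternating: "p < t \<Longrightarrow> alternating c d t ! p = (if even p then c else d)"
  by (induction t arbitrary: c d p) (auto simp: nth_Cons split: nat.split)

lemma alternating_snoc: "alternating c d (Suc t) = alternating c d t @ [if even t then c else d]"
  by (induction t arbitrary: c d) auto

lemma concat_replicate_alternating: "concat (replicate k [c, d]) = alternating c d (2 * k)"
  by (induction k) auto

lemma set_alternating: "set (alternating c d t) \<subseteq> {c, d}"
  by (induction t arbitrary: c d) auto

text \<open>A parity clock: for positive \<open>s\<close>, \<open>turn s\<close> is the last letter
  used in \<open>winding R s\<close>, hence the letter that unwinds it.\<close>

definition turn :: "nat \<Rightarrow> nat" where
  "turn s = (if even s then 1 else 2)"

lemma turn_simps [simp]: "turn (Suc (Suc s)) = turn s" "turn s \<noteq> turn (Suc s)" "turn (Suc s) \<noteq> turn s"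
  by (auto simp: turn_def)

definition winding :: "quiver \<Rightarrow> nat \<Rightarrow> quiver" where
  "winding R s = mutate_seq (alternating 2 1 s) R"

lemma winding_0 [simp]: "winding R 0 = R"
  by (simp add: winding_def)

lemma winding_Suc: "winding R (Suc s) = mutate (turn (Suc s)) (winding R s)"
  by (simp add: winding_def alternating_snoc turn_def del: alternating.simps(2))

lemma quiver_on_winding: "quiver_on m R \<Longrightarrow> quiver_on m (winding R s)"
  by (simp add: winding_def quiver_on_mutate_seq)

lemma winding_back: "mutate (turn (Suc s)) (winding R (Suc s)) = winding R s"
  by (simp add: winding_Suc mutate_mutate)

text \<open>\<open>R\<close> is acyclic and thus no spiral, so the statement begins after one
  mutation. This is what limits the forced stretch by the number of windings.\<close>

lemma spiral_winding:
  assumes "quiver_on m R" "n \<ge> 4" "\<And>i j. 1 \<le> i \<Longrightarrow> i < j \<Longrightarrow> j < n \<Longrightarrow> R i j \<ge> 2"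
  shows "spiral n (turn (Suc s)) (turn s) (winding R (Suc s))"
proof (induction s)
  case 0
  then show ?case
    using spiral_start[OF assms] by (simp add: winding_Suc turn_def)
next
  case (Suc s)
  then show ?case
    using spiral_mutate[OF Suc quiver_on_winding[OF assms(1)]] winding_Suc[of R "Suc s"] by simp
qed

text \<open>Induction on the windings left. A letter other than \<open>turn s\<close> either
  backtracks, which the prefix \<open>turn (Suc s)\<close> forbids, or opens a fork, after which the
  walk cannot end outside the forks.\<close>

lemma forced_ray:
  assumes R: "quiver_on (n - 1) R" "n \<ge> 4" "\<And>i j. 1 \<le> i \<Longrightarrow> i < j \<Longrightarrow> j < n \<Longrightarrow> R i j \<ge> 2"
    and "quiver_on n B" "full_subquiver (n - 1) B = winding R s"
    and "s > 0 \<Longrightarrow> phase1 n (turn s) (turn (Suc s)) B \<or> phase2 n (turn s) (turn (Suc s)) B"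
    and "set ks \<subseteq> {1..n}" "distinct_adj (turn (Suc s) # ks)" "\<And>r. \<not> fork n r (mutate_seq ks B)"
    and "p < length ks" "p < s"
  shows "ks ! p = (if even p then turn s else turn (Suc s))"
  using assms(4-)
proof (induction s arbitrary: B ks p)
  case (Suc s)
  let ?c = "turn (Suc s)" and ?d = "turn s"
  obtain i ks' where ks: "ks = i # ks'"
    using Suc.prems by (cases ks) auto
  have q: "quiver_on n B" and i: "i \<in> {1..n}" "set ks' \<subseteq> {1..n}" and adj: "distinct_adj (i # ks')"
    and id: "i \<noteq> ?d"
    using Suc.prems unfolding ks by auto
  have sp: "spiral n ?c ?d B"
    using spiral_winding[OF R, of s] spiral_full_subquiver[OF R(2), of _ _ B] Suc.prems(2) by simp
  have ph: "phase1 n ?c ?d B \<or> phase2 n ?c ?d B"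
    using Suc.prems(3) by simp
  have ic: "i = ?c"
  proof (rule ccontr)
    assume "i \<noteq> ?c"
    then have "fork n i (mutate i B)"
      using fork_mutate_if_opens_fork[OF ray_opens_fork[OF sp q R(2) ph i(1)]] id by blast
    then show False
      using fork_mutate_seq[OF _ i(2) adj] Suc.prems(6) unfolding ks by auto
  qed
  have t: "?c \<in> {1..n - 1}" using R(2) by (auto simp: turn_def)
  show ?case
  proof (cases p)
    case 0
    then show ?thesis using ic ks by simp
  next
    case (Suc p')
    have "ks' ! p' = (if even p' then turn s else turn (Suc s))"
    proof (rule Suc.IH[where B = "mutate ?c B"])
      show "quiver_on n (mutate ?c B)" using quiver_on_mutate[OF q] .
      show "full_subquiver (n - 1) (mutate ?c B) = winding R s"
        using full_subquiver_mutate[OF q t] Suc.prems(2) winding_back by simp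
      show "phase1 n (turn s) ?c (mutate ?c B) \<or> phase2 n (turn s) ?c (mutate ?c B)"
        using phase_mutate[OF sp q R(2)] ph by blast
    qed (use Suc.prems Suc ks ic i adj in auto)
    then show ?thesis
      using Suc ks by simp
  qed
qed simp

text \<open>The first step is separate because the preceding letter is \<open>n\<close>: the other
  letter of the alternation is then no backtracking and must be excluded by a fork as well.\<close>

lemma forced_start:
  assumes R: "quiver_on (n - 1) R" "n \<ge> 4" "\<And>i j. 1 \<le> i \<Longrightarrow> i < j \<Longrightarrow> j < n \<Longrightarrow> R i j \<ge> 2"
    and q: "quiver_on n B" and sub: "full_subquiver (n - 1) B = winding R s" and ph: "phase0 n B"
    and ks: "set ks \<subseteq> {1..n}" "distinct_adj (n # ks)" "\<And>r. \<not> fork n r (mutate_seq ks B)"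
    and p: "p < length ks" "p < s"
  shows "ks ! p = (if even p then turn s else turn (Suc s))"
proof -
  obtain s' where s: "s = Suc s'" using p by (cases s) auto
  let ?c = "turn s" and ?d = "turn (Suc s)"
  obtain i ks' where k: "ks = i # ks'"
    using p by (cases ks) auto
  have i: "i \<in> {1..n}" "set ks' \<subseteq> {1..n}" and adj: "distinct_adj (i # ks')" and ni: "i \<noteq> n"
    using ks unfolding k by auto
  have sp: "spiral n ?c ?d B"
    using spiral_winding[OF R, of s'] spiral_full_subquiver[OF R(2), of _ _ B] sub s by simp
  have ic: "i = ?c"
  proof (rule ccontr)
    assume "i \<noteq> ?c"
    then have "fork n i (mutate i B)"
      using fork_mutate_if_opens_fork[OF start_opens_fork[OF sp q R(2) ph i(1)]] ni by blast
    then show False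
      using fork_mutate_seq[OF _ i(2) adj] ks(3) unfolding k by auto
  qed
  have t: "?c \<in> {1..n - 1}" using R(2) by (auto simp: turn_def)
  show ?thesis
  proof (cases p)
    case 0
    then show ?thesis using ic k by simp
  next
    case (Suc p')
    have "ks' ! p' = (if even p' then turn s' else turn (Suc s'))"
    proof (rule forced_ray[OF R, where B = "mutate ?c B"])
      show "quiver_on n (mutate ?c B)" using quiver_on_mutate[OF q] .
      show "full_subquiver (n - 1) (mutate ?c B) = winding R s'"
        using full_subquiver_mutate[OF q t] sub winding_back s by simp
      show "phase1 n (turn s') (turn (Suc s')) (mutate ?c B) \<or> phase2 n (turn s') (turn (Suc s')) (mutate ?c B)"
        using phase_mutate[OF sp q R(2)] ph s by simp
      show "\<not> fork n r (mutate_seq ks' (mutate ?c B))" for r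
        using ks(3) ic k by simp
    qed (use p Suc s k ic i adj in auto)
    then show ?thesis
      using Suc k s by simp
  qed
qed

section \<open>The base quiver on a mutation cycle\<close>

text \<open>The cycle is rotated to start at \<open>Q\<close>. Cyclic distinctness is split into
  \<open>distinct_adj\<close> and distinct end letters, a form that survives reversal.\<close>

lemma closed_walk_at_visited:
  assumes "mutation_cycle n P ks" "Q \<in> visited P ks"
  obtains ks' where "length ks' = length ks" "set ks' \<subseteq> {1..n}" "ks' \<noteq> []"
    "mutate_seq ks' Q = Q" "distinct_adj ks'" "hd ks' \<noteq> last ks'"
proof -
  let ?L = "length ks"
  have ks: "ks \<noteq> []" "set ks \<subseteq> {1..n}" and adj: "\<And>m. m < ?L \<Longrightarrow> ks ! m \<noteq> ks ! (Suc m mod ?L)"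
    and closed: "mutate_seq ks P = P"
    using assms(1) unfolding mutation_cycle_def by blast+
  have L: "0 < ?L" using ks by simp
  obtain m where m: "m \<le> ?L" "Q = mutate_seq (take m ks) P"
    using assms(2) unfolding visited_def by blast
  obtain m where m: "m < ?L" "Q = mutate_seq (take m ks) P"
  proof (cases "m = ?L")
    case True
    then have "Q = mutate_seq (take 0 ks) P" using m closed by simp
    then show ?thesis using that L by blast
  next
    case False
    then show ?thesis using m that[of m] by simp
  qed
  let ?r = "rotate m ks"
  have r: "?r = drop m ks @ take m ks"
    using m(1) by (simp add: rotate_drop_take)
  have step: "?r ! i \<noteq> ?r ! (Suc i mod ?L)" if "i < ?L" for i
  proof -
    have "?r ! i = ks ! ((m + i) mod ?L)" "?r ! (Suc i mod ?L) = ks ! ((m + Suc i mod ?L) mod ?L)"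
      using that L by (simp_all add: nth_rotate)
    moreover have "(m + Suc i mod ?L) mod ?L = Suc ((m + i) mod ?L) mod ?L"
      by (simp add: mod_add_right_eq mod_Suc_eq)
    ultimately show ?thesis
      using adj[of "(m + i) mod ?L"] L by simp
  qed
  show ?thesis
  proof (rule that[of ?r])
    have "mutate_seq (drop m ks) (mutate_seq (take m ks) P) = P"
      using closed by (metis append_take_drop_id fold_append comp_apply)
    then show "mutate_seq ?r Q = Q"
      by (simp add: r m(2))
    show "distinct_adj ?r"
      unfolding distinct_adj_conv_nth
    proof (intro allI impI)
      fix i assume "Suc i < length ?r"
      then show "?r ! i \<noteq> ?r ! Suc i"
        using step[of i] by simp
    qed
    show "hd ?r \<noteq> last ?r"
      using step[of "?L - 1"] L ks by (simp add: hd_conv_nth last_conv_nth)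
  qed (use ks in auto)
qed

lemma mutate_seq_entry_12:
  assumes "set ks \<subseteq> {1, 2}"
  shows "mutate_seq ks B 1 2 = (-1) ^ length ks * B 1 2"
  using assms by (induction ks arbitrary: B) (auto simp: mutate_apply)

locale wound_quiver =
  fixes n k :: nat and R Q :: quiver
  assumes n: "n \<ge> 4" and k: "k \<ge> 1"
    and R: "quiver_on (n - 1) R" "\<And>i j. 1 \<le> i \<Longrightarrow> i < j \<Longrightarrow> j < n \<Longrightarrow> R i j \<ge> 2"
    and Q: "quiver_on n Q" "full_subquiver (n - 1) Q = winding R (2 * k)"
    and sink: "\<And>i. 1 \<le> i \<Longrightarrow> i < n \<Longrightarrow> Q i n \<ge> 2"
begin

lemma base_sink: "Q n j \<le> 0"
proof (cases "1 \<le> j \<and> j < n")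
  case True
  then show ?thesis using sink[of j] quiver_on_skew[OF Q(1), of n j] by simp
next
  case False
  then show ?thesis
    using quiver_on_outside[OF Q(1), of n j] quiver_on_diag[OF Q(1), of n] by (cases "j = n") auto
qed

lemma base_not_fork: "\<not> fork n r Q"
  using fork_no_sink[of n r Q n] base_sink n by (fastforce simp: not_less[symmetric])

lemma base_phase0: "phase0 n Q"
  using sink unfolding phase0_def by blast

lemma base_spiral: "spiral n 1 2 Q"
proof -
  have "spiral n (turn (Suc (2 * k - 1))) (turn (2 * k - 1)) (winding R (Suc (2 * k - 1)))"
    by (rule spiral_winding[OF R(1) n R(2)])
  then have "spiral n 1 2 (winding R (2 * k))"
    using k by (simp add: turn_def)
  then show ?thesis
    using spiral_full_subquiver[OF n] Q(2) by metis
qed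

lemma mutate_base:
  "mutate n Q i j = (if n = i \<or> n = j then - Q i j else Q i j)"
  by (rule mutate_sink[OF Q(1) base_sink])

lemma mutate_base_phase0: "phase0 n (mutate n Q)"
  using sink unfolding phase0_def by (auto simp: mutate_base)

lemma mutate_base_full_subquiver: "full_subquiver (n - 1) (mutate n Q) = winding R (2 * k)"
proof -
  have "full_subquiver (n - 1) (mutate n Q) = full_subquiver (n - 1) Q"
    by (intro ext) (auto simp: full_subquiver_def mutate_base)
  then show ?thesis using Q(2) by simp
qed

text \<open>\<open>Q\<close> is a start of a ray with next letter 1. Any other letter except
  \<open>n\<close> opens a fork, and no fork walk returns to \<open>Q\<close>, which has a
  sink.\<close>

lemma closed_walk_hd:
  assumes "set ks \<subseteq> {1..n}" "distinct_adj ks" "ks \<noteq> []" "mutate_seq ks Q = Q"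
  shows "hd ks = 1 \<or> hd ks = n"
proof (rule ccontr)
  assume h: "\<not> (hd ks = 1 \<or> hd ks = n)"
  obtain i ks' where ks: "ks = i # ks'" using assms(3) by (cases ks) auto
  have "fork n i (mutate i Q)"
    using h assms(1) unfolding ks
    by (intro fork_mutate_if_opens_fork start_opens_fork[OF base_spiral Q(1) n base_phase0]) auto
  then have "\<exists>r. fork n r (mutate_seq ks' (mutate i Q))"
    using assms(1,2) unfolding ks by (intro fork_mutate_seq) auto
  then show False
    using base_not_fork assms(4) unfolding ks by simp
qed

lemma closed_walk_long_aux:
  assumes "set ks \<subseteq> {1..n}" "distinct_adj ks" "ks \<noteq> []" "mutate_seq ks Q = Q"
    and "hd ks = n" "last ks \<noteq> n"
  shows "length ks > 4 * k + 1"
proof (rule ccontr)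
  assume short: "\<not> length ks > 4 * k + 1"
  obtain ks' where ks: "ks = n # ks'" using assms(3,5) by (cases ks) auto
  let ?L = "length ks'"
  have L: "?L \<le> 4 * k" "?L > 0" using short assms(6) ks by (auto split: if_splits)
  have t: "turn (2 * k) = 1" "turn (Suc (2 * k)) = 2" by (simp_all add: turn_def)
  have front: "ks' ! p = (if even p then 1 else 2)" if "p < ?L" "p < 2 * k" for p
  proof -
    have "ks' ! p = (if even p then turn (2 * k) else turn (Suc (2 * k)))"
      by (rule forced_start[OF R(1) n R(2) quiver_on_mutate[OF Q(1)] mutate_base_full_subquiver mutate_base_phase0])
        (use assms(1,2,4) base_not_fork that in \<open>auto simp: ks\<close>)
    then show ?thesis by (simp add: t)
  qed
  \<comment> \<open>Read backwards, the walk is a ray from \<open>Q\<close> itself. The last letter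
    is not \<open>n\<close>, so this ray too may be prefixed by \<open>n\<close> without
    backtracking.\<close>
  have rear: "ks' ! (?L - Suc p) = (if even p then 1 else 2)" if "p < ?L" "p < 2 * k" for p
  proof -
    have "rev ks ! p = (if even p then turn (2 * k) else turn (Suc (2 * k)))"
    proof (rule forced_start[OF R(1) n R(2) Q base_phase0])
      show "distinct_adj (n # rev ks)"
        using assms(2,3,6) by (auto simp: distinct_adj_Cons hd_rev)
      show "\<not> fork n r (mutate_seq (rev ks) Q)" for r
        using mutate_seq_rev[of ks Q] assms(4) base_not_fork by simp
    qed (use assms(1) that in \<open>auto simp: ks\<close>)
    moreover have "rev ks ! p = ks' ! (?L - Suc p)"
      using that by (simp add: ks nth_append rev_nth)
    ultimately show ?thesis by (simp add: t)
  qed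
  \<comment> \<open>For even length the two forced alternating pieces collide in the middle; for odd length they
    force all letters, and each letter 1 or 2 flips the sign of the entry \<open>(1, 2)\<close>.\<close>
  show False
  proof (cases "even ?L")
    case True
    then obtain h where h: "?L = 2 * h" by blast
    then have "h > 0" "h - 1 < 2 * k" "h - 1 < ?L" "?L - Suc (h - 1) = h" using L by auto
    then have "ks' ! (h - 1) = ks' ! h"
      using front[of "h - 1"] rear[of "h - 1"] by simp
    moreover have "distinct_adj ks'" using assms(2) ks by (cases ks') auto
    moreover have "Suc (h - 1) < ?L" "Suc (h - 1) = h" using \<open>h > 0\<close> h by auto
    ultimately show False
      unfolding distinct_adj_conv_nth by metis
  next
    case False
    have "ks' ! p \<in> {1, 2}" if "p < ?L" for p
    proof (cases "p < 2 * k")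
      case True
      then show ?thesis using front that by simp
    next
      case False
      have "?L \<noteq> 4 * k" using \<open>odd ?L\<close> by auto
      then have "?L - Suc p < ?L" "?L - Suc p < 2 * k" "?L - Suc (?L - Suc p) = p"
        using False L that by auto
      then show ?thesis using rear[of "?L - Suc p"] by simp
    qed
    then have "set ks' \<subseteq> {1, 2}"
      by (metis in_set_conv_nth subsetI)
    then have "mutate_seq ks' (mutate n Q) 1 2 = - mutate n Q 1 2"
      using mutate_seq_entry_12 False by simp
    then have "Q 1 2 = - Q 1 2"
      using assms(4) ks n by (simp add: mutate_base)
    then show False
      using base_spiral unfolding spiral_def by simp
  qed
qed

text \<open>First and last letter lie in \<open>{1, n}\<close>, by the same lemma applied to the
  walk and its reverse, and they differ. Up to reversal the walk thus begins with \<open>n\<close>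
  and does not end with it.\<close>

lemma base_not_on_short_cycle:
  assumes "length ks \<le> 4 * k + 1"
  shows "\<not> lies_on_cycle n Q P ks"
proof
  assume "lies_on_cycle n Q P ks"
  then obtain ks' where ks': "length ks' = length ks" "set ks' \<subseteq> {1..n}" "ks' \<noteq> []"
    "mutate_seq ks' Q = Q" "distinct_adj ks'" "hd ks' \<noteq> last ks'"
    using closed_walk_at_visited unfolding lies_on_cycle_def by metis
  have r: "set (rev ks') \<subseteq> {1..n}" "distinct_adj (rev ks')" "rev ks' \<noteq> []" "mutate_seq (rev ks') Q = Q"
    using ks' mutate_seq_rev[of ks' Q] by auto
  have "hd ks' = n \<or> last ks' = n"
    using closed_walk_hd[OF ks'(2,5,3,4)] closed_walk_hd[OF r] ks'(3,6) by (auto simp: hd_rev)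
  then have "length ks' > 4 * k + 1"
    using closed_walk_long_aux[OF ks'(2,5,3,4)] closed_walk_long_aux[OF r] ks'(3,6)
    by (auto simp: hd_rev last_rev)
  then show False
    using assms ks'(1) by simp
qed

end

section \<open>The long mutation cycle\<close>

text \<open>When a vertex has its turn, \<open>n\<close> and all lower vertices point to it, and its
  arrows to higher vertices have already been reversed. It is a sink, and only signs change.\<close>

lemma mutate_seq_sinks:
  assumes B: "quiver_on n B" "\<And>i j. 1 \<le> i \<Longrightarrow> i < j \<Longrightarrow> j < n \<Longrightarrow> B i j > 0"
    and sinks: "\<And>j. m \<le> j \<Longrightarrow> j < n \<Longrightarrow> B j n < 0" and m: "1 \<le> m" "m \<le> n"
  shows "mutate_seq (rev [m..<n]) B i j =
    (if m \<le> i \<and> i < n then -1 else 1) * (if m \<le> j \<and> j < n then -1 else 1) * B i j"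
  using m(2) m(1) sinks
proof (induction m arbitrary: i j rule: inc_induct)
  case (step m)
  let ?S = "mutate_seq (rev [Suc m..<n]) B"
  have S: "?S i j = (if Suc m \<le> i \<and> i < n then -1 else 1) * (if Suc m \<le> j \<and> j < n then -1 else 1) * B i j" for i j
    using step by simp
  have "?S m j \<le> 0" for j
  proof -
    consider "j = m" | "j = n" | "j < 1 \<or> j > n" | "1 \<le> j" "j < m" | "m < j" "j < n"
      by linarith
    then show ?thesis
    proof cases
      case 1
      then show ?thesis using S quiver_on_diag[OF B(1), of m] by simp
    next
      case 2
      then show ?thesis using S step.hyps step.prems(2)[of m] by simp
    next
      case 3
      then show ?thesis using S quiver_on_outside[OF B(1), of m j] by auto
    next
      case 4
      then show ?thesis using S B(2)[of j m] step.hyps quiver_on_skew[OF B(1), of m j] by simp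
    next
      case 5
      then show ?thesis using S B(2)[of m j] step by simp
    qed
  qed
  then have sink: "mutate m ?S i j = (if m = i \<or> m = j then - ?S i j else ?S i j)"
    by (rule mutate_sink[OF quiver_on_mutate_seq[OF B(1)]])
  have "mutate_seq (rev [m..<n]) B i j = mutate m ?S i j"
    using step.hyps by (simp add: upt_conv_Cons)
  then show ?case
    unfolding sink S using quiver_on_diag[OF B(1), of i] step.hyps by (cases "i = j") auto
qed auto

text \<open>The vertices \<open>n-1,...,3\<close> are sinks in their turn; 2 and 1 are sinks only
  within \<open>[1,n-1]\<close>, so their mutations alter the column of \<open>n\<close>. Inside
  \<open>[1,n-1]\<close> every entry changes sign twice. The number \<open>v\<close> is the entry
  \<open>(1,n)\<close> after the mutation at 2.\<close>

lemma mutate_seq_sweep: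
  fixes B :: quiver and n :: nat
  defines "F \<equiv> mutate_seq (rev [1..<n]) B" and "v \<equiv> B 1 n + B 1 2 * B 2 n"
  assumes n: "n \<ge> 4" and B: "quiver_on n B" "\<And>i j. 1 \<le> i \<Longrightarrow> i < j \<Longrightarrow> j < n \<Longrightarrow> B i j > 0"
    and low: "\<And>j. 3 \<le> j \<Longrightarrow> j < n \<Longrightarrow> B j n < 0" and top: "B 2 n > 0" "v > 0"
  shows "\<And>i j. 1 \<le> i \<Longrightarrow> i < j \<Longrightarrow> j < n \<Longrightarrow> F i j = B i j"
    and "F 1 n = - v" and "F 2 n = B 1 2 * v - B 2 n"
    and "\<And>j. 3 \<le> j \<Longrightarrow> j < n \<Longrightarrow> F j n = B 2 j * B 2 n + B 1 j * v - B j n"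
proof -
  define S where "S = mutate_seq (rev [3..<n]) B"
  have S: "S i j = (if 3 \<le> i \<and> i < n then -1 else 1) * (if 3 \<le> j \<and> j < n then -1 else 1) * B i j" for i j
    unfolding S_def by (rule mutate_seq_sinks[OF B low]) (use n in auto)
  define G where "G = mutate 2 S"
  have qS: "quiver_on n S" and qG: "quiver_on n G"
    unfolding G_def S_def using B(1) by (auto intro: quiver_on_mutate quiver_on_mutate_seq)
  have "[1..<n] = 1 # 2 # [3..<n]"
    using n by (simp add: upt_conv_Cons numeral_eq_Suc)
  then have F: "F = mutate 1 G"
    unfolding F_def G_def S_def by simp
  have b: "B 1 2 > 0" using B(2)[of 1 2] n by simp
  have bj: "B 1 j > 0" "B 2 j > 0" if "3 \<le> j" "j < n" for j
    using B(2) that by simp_all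
  have S12: "S 1 2 = B 1 2" "S 2 1 = - B 1 2" "S 1 n = B 1 n" "S 2 n = B 2 n"
    using quiver_on_skew[OF B(1), of 2 1] n by (simp_all add: S)
  have Sj: "S 1 j = - B 1 j" "S 2 j = - B 2 j" "S j 2 = B 2 j" "S j n = - B j n" if "3 \<le> j" "j < n" for j
    using quiver_on_skew[OF B(1), of j 2] that n by (simp_all add: S)
  have Sij: "S i j = B i j" if "3 \<le> i" "i < n" "3 \<le> j" "j < n" for i j
    using that by (simp add: S)
  have G12: "G 1 2 = - B 1 2" "G 2 1 = B 1 2" "G 1 n = v" "G 2 n = - B 2 n"
    using S12 b top n by (auto simp: G_def mutate_apply v_def)
  have Gj: "G 1 j = - B 1 j" "G 2 j = B 2 j" "G j n = B 2 j * B 2 n - B j n" if "3 \<le> j" "j < n" for j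
    using S12 Sj[OF that] bj[OF that] b top n that by (auto simp: G_def mutate_apply)
  have Gj': "G j 1 = B 1 j" if "3 \<le> j" "j < n" for j
    using Gj[OF that] quiver_on_skew[OF qG, of j 1] by simp
  have Gij: "G i j = B i j" if "3 \<le> i" "i < j" "j < n" for i j
    using Sij[of i j] Sj[of i] Sj[of j] bj[of i] bj[of j] that by (auto simp: G_def mutate_apply)
  show "F 1 n = - v" "F 2 n = B 1 2 * v - B 2 n"
    using G12 b top n by (auto simp: F mutate_apply)
  show "F j n = B 2 j * B 2 n + B 1 j * v - B j n" if "3 \<le> j" "j < n" for j
    using G12 Gj[OF that] Gj'[OF that] bj[OF that] top n that by (auto simp: F mutate_apply)
  show "F i j = B i j" if "1 \<le> i" "i < j" "j < n" for i j
  proof -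
    consider "i = 1" "j = 2" | "i = 1" "3 \<le> j" | "i = 2" "3 \<le> j" | "3 \<le> i"
      using \<open>1 \<le> i\<close> \<open>i < j\<close> by linarith
    then show ?thesis
    proof cases
      case 1
      then show ?thesis using G12 by (simp add: F mutate_apply)
    next
      case 2
      then show ?thesis using Gj that by (simp add: F mutate_apply)
    next
      case 3
      then show ?thesis using Gj[of j] G12 bj[of j] that b by (simp add: F mutate_apply)
    next
      case 4
      then show ?thesis using Gij[of i j] Gj[of j] Gj'[of i] bj[of i] bj[of j] that by (simp add: F mutate_apply)
    qed
  qed
qed

text \<open>A quantity conserved along the ray from the source side. It records what the first two steps
  from the sink side add to the entry \<open>(j, n)\<close>.\<close>

definition moment :: "nat \<Rightarrow> nat \<Rightarrow> nat \<Rightarrow> quiver \<Rightarrow> nat \<Rightarrow> int" where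
  "moment n c d B j = - (B j c * B c n + (B c d * B j c - B d j) * B d n)"

text \<open>The coefficient of \<open>B d n\<close> is the entry \<open>(j,d)\<close> after mutating
  at \<open>c\<close>. The pair of coefficients thus transforms inversely to the pair of column
  entries.\<close>

lemma moment_mutate:
  assumes "quiver_on n B" "B c d > 0" "B j c > 0" "B c n < 0" "c \<noteq> d" "c \<noteq> n" "d \<noteq> n" "c \<noteq> j"
  shows "moment n d c (mutate c B) j = moment n c d B j"
proof -
  note m = mutate_column[OF assms(1,2,6,7)]
  have jd: "mutate c B j d = B c d * B j c - B d j"
    using assms quiver_on_skew[OF assms(1), of j d] by (simp add: mutate_apply)
  then show ?thesis
    unfolding moment_def m(1) m(2)[of j] m(3) m(5)[OF assms(4)] jd by (simp add: algebra_simps)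
qed

lemma rev_alternating_even: "rev (alternating c d (2 * k)) = alternating d c (2 * k)"
proof (induction k)
  case (Suc k)
  have "alternating d c (2 * Suc k) = alternating d c (Suc (Suc (2 * k)))" by simp
  also have "\<dots> = alternating d c (2 * k) @ [d, c]"
    by (simp add: alternating_snoc del: alternating.simps(2))
  finally show ?case
    using Suc by simp
qed simp

lemma distinct_adj_alternating: "c \<noteq> d \<Longrightarrow> distinct_adj (alternating c d t)"
  unfolding distinct_adj_conv_nth by (auto simp: nth_alternating)

lemma mutation_cycleI:
  assumes "quiver_on n P" "ks \<noteq> []" "set ks \<subseteq> {1..n}" "distinct_adj ks" "hd ks \<noteq> last ks"
    and "\<And>i. i \<in> {1..n} \<Longrightarrow> \<not> isolated i P" "mutate_seq ks P = P"
  shows "mutation_cycle n P ks"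
proof -
  have "ks ! m \<noteq> ks ! (Suc m mod length ks)" if "m < length ks" for m
  proof (cases "Suc m = length ks")
    case True
    then have "ks ! m = last ks"
      using last_conv_nth[OF assms(2)] by (metis diff_Suc_1)
    then show ?thesis
      using True assms(2,5) by (simp add: hd_conv_nth)
  next
    case False
    then show ?thesis
      using assms(4) that unfolding distinct_adj_conv_nth by simp
  qed
  moreover have "\<not> isolated (ks ! m) (mutate_seq (take m ks) P)" if "m < length ks" for m
    using isolated_mutate_seq assms(3,6) nth_mem[OF that] by blast
  ultimately show ?thesis
    using assms unfolding mutation_cycle_def by blast
qed

section \<open>The two rays and the sweep joining their ends\<close>

context wound_quiver
begin

text \<open>\<open>near\<close> starts at the quiver where \<open>n\<close> is a sink, \<open>far\<close> at its mutation at \<open>n\<close>. After two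
  steps, \<open>near\<close> repeats the entries \<open>(1, n)\<close> and \<open>(2, n)\<close> of \<open>far\<close> with a delay of two.\<close>

definition far :: "nat \<Rightarrow> quiver" where
  "far t = mutate_seq (alternating 1 2 t) (mutate n Q)"

definition near :: "nat \<Rightarrow> quiver" where
  "near t = mutate_seq (alternating 1 2 t) Q"

lemma far_0: "far 0 = mutate n Q"
  by (simp add: far_def)

lemma far_Suc: "far (Suc t) = mutate (turn t) (far t)"
  by (simp add: far_def alternating_snoc turn_def del: alternating.simps(2))

lemma near_Suc: "near (Suc t) = mutate (turn t) (near t)"
  by (simp add: near_def alternating_snoc turn_def del: alternating.simps(2))

lemma quiver_on_far: "quiver_on n (far t)" and quiver_on_near: "quiver_on n (near t)"
  unfolding far_def near_def using Q(1) by (auto intro: quiver_on_mutate quiver_on_mutate_seq)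

lemma turn_bounds: "1 \<le> turn t" "turn t < 3" "turn t < n" "turn t \<in> {1..n - 1}"
  using n by (auto simp: turn_def)

lemma turn_diff: "t \<le> 2 * k \<Longrightarrow> turn (2 * k - t) = turn t"
  by (auto simp: turn_def)

lemma near_full_subquiver: "t \<le> 2 * k \<Longrightarrow> full_subquiver (n - 1) (near t) = winding R (2 * k - t)"
proof (induction t)
  case 0
  then show ?case using Q(2) by (simp add: near_def)
next
  case (Suc t)
  have s: "2 * k - t = Suc (2 * k - Suc t)"
    using Suc.prems by simp
  then have t: "turn t = turn (Suc (2 * k - Suc t))"
    using turn_diff[of t] Suc.prems by (metis Suc_leD)
  have "full_subquiver (n - 1) (near (Suc t)) = mutate (turn t) (winding R (2 * k - t))"
    using Suc full_subquiver_mutate[OF quiver_on_near turn_bounds(4)] unfolding near_Suc by simp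
  then show ?case
    unfolding s t using winding_back by simp
qed

lemma far_full_subquiver: "t \<le> 2 * k \<Longrightarrow> full_subquiver (n - 1) (far t) = winding R (2 * k - t)"
proof (induction t)
  case 0
  then show ?case using mutate_base_full_subquiver by (simp add: far_0)
next
  case (Suc t)
  have s: "2 * k - t = Suc (2 * k - Suc t)"
    using Suc.prems by simp
  then have t: "turn t = turn (Suc (2 * k - Suc t))"
    using turn_diff[of t] Suc.prems by (metis Suc_leD)
  have "full_subquiver (n - 1) (far (Suc t)) = mutate (turn t) (winding R (2 * k - t))"
    using Suc full_subquiver_mutate[OF quiver_on_far turn_bounds(4)] unfolding far_Suc by simp
  then show ?case
    unfolding s t using winding_back by simp
qed

lemma spiral_of_winding:
  assumes "full_subquiver (n - 1) B = winding R (2 * k - t)" "t < 2 * k"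
  shows "spiral n (turn t) (turn (Suc t)) B"
proof -
  have s: "2 * k - t = Suc (2 * k - Suc t)" "turn (2 * k - t) = turn t" "turn (2 * k - Suc t) = turn (Suc t)"
    using assms(2) turn_diff[of t] turn_diff[of "Suc t"] by auto
  then show ?thesis
    using spiral_winding[OF R(1) n R(2), of "2 * k - Suc t"] spiral_full_subquiver[OF n] assms(1) by metis
qed

text \<open>With \<open>B c d\<close> at least 2, the new entry \<open>B d n + B c d * B c n\<close>
  and its sum with \<open>- B c n\<close> stay negative. Every step therefore mutates at a
  \<open>c\<close> with \<open>B c n < 0\<close>, which leaves the entries \<open>(j,n)\<close>
  untouched and conserves the moment.\<close>

lemma far_invariant:
  assumes "t \<le> 2 * k"
  shows "far t (turn t) n < 0 \<and> far t (turn t) n + far t (turn (Suc t)) n < 0 \<and>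
    (t > 0 \<longrightarrow> far t (turn (Suc t)) n > 0) \<and>
    (\<forall>j. 3 \<le> j \<longrightarrow> j < n \<longrightarrow> far t j n = - Q j n \<and>
       moment n (turn t) (turn (Suc t)) (far t) j = moment n 1 2 (mutate n Q) j)"
  using assms
proof (induction t)
  case 0
  have "mutate n Q i n \<le> -2" if "1 \<le> i" "i < n" for i
    using sink[OF that] that by (simp add: mutate_base)
  from this[of 1] this[of 2] show ?case
    using n by (simp add: far_0 turn_def mutate_base)
next
  case (Suc t)
  let ?B = "far t" and ?c = "turn t" and ?d = "turn (Suc t)"
  have sp: "spiral n ?c ?d ?B"
    using spiral_of_winding far_full_subquiver Suc.prems by simp
  have b: "?B ?c ?d \<ge> 2" and j: "\<And>j. 3 \<le> j \<Longrightarrow> j < n \<Longrightarrow> ?B j ?c > 0"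
    using sp unfolding spiral_def by force+
  have ne: "?c \<noteq> n" "?d \<noteq> n" "?c \<noteq> ?d" using turn_bounds(3)[of t] turn_bounds(3)[of "Suc t"] by auto
  have IH: "?B ?c n < 0" "?B ?c n + ?B ?d n < 0"
    "\<And>j. 3 \<le> j \<Longrightarrow> j < n \<Longrightarrow> ?B j n = - Q j n \<and> moment n ?c ?d ?B j = moment n 1 2 (mutate n Q) j"
    using Suc by simp_all
  have b0: "?B ?c ?d > 0" using b by simp
  note m = mutate_column[OF quiver_on_far b0 ne(1,2)]
  have "?B ?c ?d * ?B ?c n \<le> 2 * ?B ?c n"
    using mult_right_mono_neg[OF b, of "?B ?c n"] IH(1) by simp
  then have "?B ?d n + ?B ?c ?d * ?B ?c n < 0" "?B ?d n + ?B ?c ?d * ?B ?c n + - ?B ?c n < 0"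
    using IH(1,2) by linarith+
  moreover have "moment n ?d ?c (mutate ?c ?B) j = moment n 1 2 (mutate n Q) j \<and> mutate ?c ?B j n = - Q j n"
    if "3 \<le> j" "j < n" for j
    using moment_mutate[OF quiver_on_far b0 j[OF that] IH(1) ne(3,1,2)] turn_bounds(2)[of t] that
      m(7)[OF IH(1) j[OF that]] IH(3)[OF that] by auto
  ultimately show ?case
    using m(1) m(5)[OF IH(1)] IH(1) by (simp add: far_Suc)
qed

lemma near_far_12:
  assumes "i \<in> {1, 2}" "j \<in> {1, 2}"
  shows "near (Suc (Suc t)) i j = far t i j"
proof -
  have "near (Suc (Suc t)) 1 2 = far t 1 2"
    unfolding near_def far_def
    using mutate_seq_entry_12[OF set_alternating, of "Suc (Suc t)" Q]
      mutate_seq_entry_12[OF set_alternating, of t "mutate n Q"] n by (simp add: mutate_base)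
  then show ?thesis
    using assms quiver_on_skew[OF quiver_on_near, of "Suc (Suc t)" 2 1] quiver_on_skew[OF quiver_on_far, of t 2 1]
      quiver_on_diag[OF quiver_on_near] quiver_on_diag[OF quiver_on_far] by auto
qed

text \<open>From positive entries the first two steps merely negate \<open>(1,n)\<close> and
  \<open>(2,n)\<close>, which yields the values of \<open>mutate n Q\<close>, and add the moment to
  each \<open>(j,n)\<close>. Afterwards both rays obey the same recursion with the same entry
  \<open>(1,2)\<close>.\<close>

lemma near_column:
  assumes "Suc (Suc t) \<le> 2 * k"
  shows "near (Suc (Suc t)) 1 n = far t 1 n \<and> near (Suc (Suc t)) 2 n = far t 2 n \<and>
    (\<forall>j. 3 \<le> j \<longrightarrow> j < n \<longrightarrow> near (Suc (Suc t)) j n = Q j n + moment n 1 2 (mutate n Q) j)"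
  using assms
proof (induction t)
  case 0
  have b: "Q 1 2 > 0" and j: "\<And>j. 3 \<le> j \<Longrightarrow> j < n \<Longrightarrow> Q j 1 > 0"
    using base_spiral unfolding spiral_def by force+
  have ne: "(1::nat) \<noteq> n" "(2::nat) \<noteq> n" using n by auto
  have s: "Q 1 n > 0" "Q 2 n > 0" using sink[of 1] sink[of 2] n by simp_all
  have N1: "near 1 = mutate 1 Q" and N2: "near 2 = mutate 2 (near 1)"
    by (simp_all add: near_def numeral_2_eq_2)
  note m = mutate_column[OF Q(1) b ne]
  have sp: "spiral n 2 1 (near 1)"
    using spiral_of_winding[of "near 1" 1] near_full_subquiver[of 1] k by (simp add: turn_def)
  have b': "near 1 2 1 > 0" and j': "\<And>j. 3 \<le> j \<Longrightarrow> j < n \<Longrightarrow> near 1 j 2 > 0"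
    using sp unfolding spiral_def by force+
  note m' = mutate_column[OF quiver_on_near b' ne(2,1)]
  have s': "near 1 2 n > 0" using m(4) s N1 by simp
  have "near 2 j n = Q j n + moment n 1 2 (mutate n Q) j" if "3 \<le> j" "j < n" for j
  proof -
    have "near 1 j 2 = Q j 2 + Q j 1 * Q 1 2"
      unfolding N1 using b j[OF that] that by (simp add: mutate_apply)
    then have "near 2 j n = Q j n + Q j 1 * Q 1 n + (Q j 2 + Q j 1 * Q 1 2) * Q 2 n"
      using m'(6)[OF s' j'[OF that]] m(6)[OF s(1) j[OF that]] m(4)[OF s(1)] that unfolding N1 N2 by simp
    moreover have "moment n 1 2 (mutate n Q) j = Q j 1 * Q 1 n + (Q 1 2 * Q j 1 - Q 2 j) * Q 2 n"
      using that n by (simp add: moment_def mutate_base)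
    ultimately show ?thesis
      using quiver_on_skew[OF Q(1), of j 2] by (simp add: algebra_simps)
  qed
  moreover have "near 2 1 n = - Q 1 n" "near 2 2 n = - Q 2 n"
    using m'(4)[OF s'] m'(1) m(1) m(4)[OF s(1)] unfolding N1 N2 by simp_all
  ultimately show ?case
    using n mutate_base[of 1 n] mutate_base[of 2 n] by (simp add: far_0 numeral_2_eq_2)
next
  case (Suc t)
  let ?N = "near (Suc (Suc t))" and ?B = "far t" and ?c = "turn t" and ?d = "turn (Suc t)"
  have sB: "spiral n ?c ?d ?B" and sN: "spiral n ?c ?d ?N"
    using spiral_of_winding[of ?B t] far_full_subquiver[of t]
      spiral_of_winding[of ?N "Suc (Suc t)"] near_full_subquiver[of "Suc (Suc t)"] Suc.prems by simp_all
  have cd: "?c = 1 \<and> ?d = 2 \<or> ?c = 2 \<and> ?d = 1" by (auto simp: turn_def)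
  have b: "?B ?c ?d > 0" "?N ?c ?d > 0" and j: "\<And>j. 3 \<le> j \<Longrightarrow> j < n \<Longrightarrow> ?N j ?c > 0"
    using sB sN unfolding spiral_def by force+
  have bb: "?N ?c ?d = ?B ?c ?d" using near_far_12[of ?c ?d t] cd by auto
  have ne: "?c \<noteq> n" "?d \<noteq> n" using turn_bounds(3)[of t] turn_bounds(3)[of "Suc t"] by auto
  have neg: "?B ?c n < 0" using far_invariant[of t] Suc.prems by simp
  have IH: "?N 1 n = ?B 1 n" "?N 2 n = ?B 2 n"
    "\<And>j. 3 \<le> j \<Longrightarrow> j < n \<Longrightarrow> ?N j n = Q j n + moment n 1 2 (mutate n Q) j"
    using Suc by simp_all
  have neg': "?N ?c n < 0" using neg IH(1,2) cd by auto
  note m = mutate_column[OF quiver_on_far b(1) ne] and m' = mutate_column[OF quiver_on_near b(2) ne]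
  have "near (Suc (Suc (Suc t))) = mutate ?c ?N" "far (Suc t) = mutate ?c ?B"
    by (simp_all add: near_Suc[of "Suc (Suc t)"] far_Suc)
  moreover have "mutate ?c ?N ?c n = mutate ?c ?B ?c n" "mutate ?c ?N ?d n = mutate ?c ?B ?d n"
    using m(1) m'(1) m(5)[OF neg] m'(5)[OF neg'] bb IH(1,2) cd by auto
  ultimately show ?case
    using cd m'(7)[OF neg' j] IH(3) by auto
qed

text \<open>Both sides restrict to \<open>R\<close>, so only the column of \<open>n\<close> is
  compared. For \<open>j\<close> from 3 on, what the sweep adds to \<open>- B j n\<close> is exactly
  the moment of \<open>far (2 * k)\<close>.\<close>

lemma sweep_far: "mutate_seq (rev [1..<n]) (far (2 * k)) = near (2 * k)"
proof -
  let ?M = "far (2 * k)" and ?P = "near (2 * k)" and ?F = "mutate_seq (rev [1..<n]) (far (2 * k))"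
  obtain l where l: "k = Suc l" using k by (cases k) auto
  have subs: "?M i j = R i j" "?P i j = R i j" if "1 \<le> i" "i < n" "1 \<le> j" "j < n" for i j
  proof -
    have "full_subquiver (n - 1) ?M i j = R i j" "full_subquiver (n - 1) ?P i j = R i j"
      using far_full_subquiver[of "2 * k"] near_full_subquiver[of "2 * k"] by simp_all
    moreover have "i \<in> {1..n-1} \<and> j \<in> {1..n-1}" using that by auto
    ultimately show "?M i j = R i j" "?P i j = R i j" by (simp_all add: full_subquiver_def)
  qed
  have t: "turn (2 * k) = 1" "turn (Suc (2 * k)) = 2" "turn (2 * l) = 1" "turn (Suc (2 * l)) = 2"
    by (simp_all add: turn_def)
  let ?b = "R 1 2"
  \<comment> \<open>Column entries of \<open>far\<close> two steps before its end, which the delay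
    identifies with those of \<open>near (2 * k)\<close>.\<close>
  define a where "a = far (2 * l) 1 n"
  define b where "b = far (2 * l) 2 n"
  have ne: "(1::nat) \<noteq> n" "(2::nat) \<noteq> n" using n by auto
  have M1: "far (Suc (2 * l)) = mutate 1 (far (2 * l))" and M2: "?M = mutate 2 (far (Suc (2 * l)))"
    by (simp_all add: far_Suc t l)
  have e: "?b > 0" using R(2)[of 1 2] n by simp
  have e0: "far (2 * l) 1 2 = ?b"
    using subs(2)[of 1 2] near_far_12[of 1 2 "2 * l"] n l by simp
  have e1: "far (Suc (2 * l)) 2 1 = ?b"
    using e0 quiver_on_skew[OF quiver_on_far, of "2 * l" 2 1] by (simp add: M1 mutate_apply)
  have an: "a < 0" using far_invariant[of "2 * l"] t l by (simp add: a_def)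
  have m: "far (Suc (2 * l)) 1 n = - a" "far (Suc (2 * l)) 2 n = b + ?b * a"
    using mutate_column[OF quiver_on_far, of "2 * l" 1 2] e0 e an ne unfolding M1 a_def b_def by auto
  have "far (Suc (2 * l)) 2 n < 0" using far_invariant[of "Suc (2 * l)"] t l by simp
  then have m': "?M 2 n = - (b + ?b * a)" "?M 1 n = - a + ?b * (b + ?b * a)"
    using mutate_column[OF quiver_on_far, of "Suc (2 * l)" 2 1] e1 e m ne unfolding M2 by auto
  have M2n: "?M 2 n > 0" using far_invariant[of "2 * k"] t k by simp
  \<comment> \<open>The sweep's mutation at 2 removes from \<open>(1,n)\<close> what the last step
    of \<open>far\<close>, also at 2, had added.\<close>
  have v: "?M 1 n + ?M 1 2 * ?M 2 n = - a"
  proof -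
    have M12: "?M 1 2 = ?b" using subs(1)[of 1 2] n by simp
    show ?thesis unfolding m' M12 by (simp add: algebra_simps)
  qed
  have Mj: "?M j n = - Q j n" "moment n 1 2 ?M j = moment n 1 2 (mutate n Q) j" if "3 \<le> j" "j < n" for j
    using far_invariant[of "2 * k"] t that by simp_all
  show ?thesis
  proof (rule quiver_on_ext)
    show "quiver_on n ?F" "quiver_on n ?P"
      using quiver_on_far quiver_on_near by (auto intro: quiver_on_mutate_seq)
    fix i j :: nat
    assume ij: "1 \<le> i" "i < j" "j \<le> n"
    have pos: "?M i j > 0" if "1 \<le> i" "i < j" "j < n" for i j
      using subs(1)[of i j] R(2)[of i j] that by simp
    have low: "?M j n < 0" if "3 \<le> j" "j < n" for j
      using Mj(1)[OF that] sink[of j] that by simp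
    have vpos: "?M 1 n + ?M 1 2 * ?M 2 n > 0" using v an by simp
    note sweep = mutate_seq_sweep[OF n quiver_on_far pos low M2n vpos]
    have sw: "1 \<le> i \<Longrightarrow> i < j \<Longrightarrow> j < n \<Longrightarrow> ?F i j = ?M i j"
      "?F 1 n = - (?M 1 n + ?M 1 2 * ?M 2 n)"
      "?F 2 n = ?M 1 2 * (?M 1 n + ?M 1 2 * ?M 2 n) - ?M 2 n"
      "3 \<le> j \<Longrightarrow> j < n \<Longrightarrow> ?F j n = ?M 2 j * ?M 2 n + ?M 1 j * (?M 1 n + ?M 1 2 * ?M 2 n) - ?M j n" for i j
      by (rule sweep; assumption)+
    have N: "?P 1 n = a" "?P 2 n = b" "\<And>j. 3 \<le> j \<Longrightarrow> j < n \<Longrightarrow> ?P j n = Q j n + moment n 1 2 ?M j"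
      using near_column[of "2 * l"] Mj(2) l by (simp_all add: a_def b_def)
    show "?F i j = ?P i j"
    proof (cases "j < n")
      case True
      then show ?thesis using sw(1)[OF ij(1,2) True] subs[of i j] ij by simp
    next
      case False
      then have jn: "j = n" using ij by simp
      consider "i = 1" | "i = 2" | "3 \<le> i" "i < n" using ij jn by linarith
      then show ?thesis
      proof cases
        case 1
        then show ?thesis using sw(2) N(1) v jn by simp
      next
        case 2
        have "?M 1 2 = ?b" using subs(1)[of 1 2] n by simp
        then have "?F 2 n = ?b * (- a) - (- (b + ?b * a))"
          using sw(3) unfolding v by (simp add: m'(1))
        then show ?thesis using N(2) 2 jn by simp
      next
        case 3
        have "?M i 1 = - ?M 1 i" using quiver_on_skew[OF quiver_on_far] .
        then show ?thesis
          using sw(4)[OF 3] N(3)[OF 3] Mj(1)[OF 3] jn unfolding moment_def by (simp add: algebra_simps)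
      qed
    qed
  qed
qed

text \<open>The word crosses the edge \<open>n\<close>, follows \<open>far\<close> to its end,
  sweeps to the end of \<open>near\<close> and runs \<open>near\<close> backwards to
  \<open>Q\<close>.\<close>

lemma base_long_cycle:
  "mutation_cycle n Q ([n] @ alternating 1 2 (2 * k) @ rev [1..<n] @ alternating 2 1 (2 * k))"
    (is "mutation_cycle n Q ?c")
proof (rule mutation_cycleI)
  obtain l where l: "k = Suc l" using k by (cases k) auto
  show "quiver_on n Q" by (rule Q(1))
  show "?c \<noteq> []" by simp
  show "set ?c \<subseteq> {1..n}"
    using set_alternating[of 1 2 "2 * k"] set_alternating[of 2 1 "2 * k"] n by auto
  have lasts: "last (alternating 1 2 (2 * k)) = 2" "last (alternating 2 1 (2 * k)) = 1"
  proof -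
    have "alternating c d (2 * k) = alternating c d (Suc (2 * l)) @ [d]" for c d
      using alternating_snoc[of c d "Suc (2 * l)"] l by (simp del: alternating.simps(2))
    then have "last (alternating c d (2 * k)) = d" for c d
      by simp
    then show "last (alternating 1 2 (2 * k)) = 2" "last (alternating 2 1 (2 * k)) = 1"
      by blast+
  qed
  have ne: "alternating c d (2 * k) \<noteq> []" for c d
    using l by simp
  have hds: "hd (alternating c d (2 * k)) = c" for c d
    using l by simp
  have r: "rev [1..<n] \<noteq> []" "hd (rev [1..<n]) = n - 1" "last (rev [1..<n]) = 1" "distinct_adj (rev [1..<n])"
    using n by (auto simp: hd_rev last_rev distinct_adj_conv_nth nth_eq_iff_index_eq)
  show "distinct_adj ?c"
    using r lasts ne hds distinct_adj_alternating[of 1 2] distinct_adj_alternating[of 2 1] n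
    by (simp add: distinct_adj_append_iff distinct_adj_Cons)
  show "hd ?c \<noteq> last ?c"
    using ne lasts n by simp
  show "\<not> isolated i Q" if "i \<in> {1..n}" for i
  proof (cases "i = n")
    case True
    have "Q n 1 \<noteq> 0" using sink[of 1] quiver_on_skew[OF Q(1), of n 1] n by simp
    then show ?thesis using True by (auto simp: isolated_def)
  next
    case False
    then have "Q i n \<noteq> 0" using sink[of i] that by simp
    then show ?thesis by (auto simp: isolated_def)
  qed
  have "mutate_seq ?c Q = mutate_seq (alternating 2 1 (2 * k)) (mutate_seq (rev [1..<n]) (far (2 * k)))"
    by (simp add: far_def)
  also have "\<dots> = mutate_seq (rev (alternating 1 2 (2 * k))) (near (2 * k))"
    unfolding sweep_far rev_alternating_even ..
  also have "\<dots> = Q"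
    unfolding near_def by (rule mutate_seq_rev)
  finally show "mutate_seq ?c Q = Q" .
qed

end

section \<open>An edge that meets no attached cell\<close>

lemma continuous_map_from_sum_topology:
  assumes "\<And>i. i \<in> I \<Longrightarrow> continuous_map (X i) Z (\<lambda>x. h (i, x))"
  shows "continuous_map (sum_topology X I) Z h"
  unfolding continuous_map_def
proof (intro conjI allI impI)
  show "h \<in> topspace (sum_topology X I) \<rightarrow> topspace Z"
    using assms by (force simp: continuous_map_def)
  fix U assume U: "openin Z U"
  have "openin (X i) {x. (i, x) \<in> {x \<in> topspace (sum_topology X I). h x \<in> U}}" if "i \<in> I" for i
  proof -
    have "{x. (i, x) \<in> {x \<in> topspace (sum_topology X I). h x \<in> U}} = {x \<in> topspace (X i). h (i, x) \<in> U}"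
      using that by auto
    then show ?thesis
      using assms[OF that] U by (simp add: continuous_map_def)
  qed
  then show "openin (sum_topology X I) {x \<in> topspace (sum_topology X I). h x \<in> U}"
    unfolding openin_sum_topology by auto
qed

lemma glue_class_imp_eq:
  assumes "glue_class X r x = glue_class X r y"
    and "\<And>a b. (a, b) \<in> r \<Longrightarrow> a \<in> topspace X \<Longrightarrow> b \<in> topspace X \<Longrightarrow> h a = h b"
  shows "h x = h y"
proof -
  let ?s = "Restr r (topspace X)"
  have "y \<in> (?s \<union> ?s\<inverse>)\<^sup>* `` {x}"
    using assms(1) by (auto simp: glue_class_def Let_def)
  then have "(x, y) \<in> (?s \<union> ?s\<inverse>)\<^sup>*" by simp
  then show ?thesis
    by (induction rule: rtrancl_induct) (use assms(2) in force)+
qed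

text \<open>Since \<open>i\<close> does not recur in \<open>ks\<close>, all other edges of the walk
  carry a different label, so this edge is traversed just once.\<close>

lemma not_paved_free_edge:
  assumes i: "i \<in> {1..n}" "mutate i Q \<noteq> Q"
    and free: "\<And>P ks. length ks \<le> L \<Longrightarrow> \<not> lies_on_cycle n Q P ks"
    and ks: "set ks \<subseteq> {1..n}" "i \<notin> set ks"
  shows "\<not> paved n L Q (i # ks)"
proof
  assume "paved n L Q (i # ks)"
  then obtain c where c: "homotopic_with (\<lambda>p. p 1 = p 0) (top_of_set {0..1}) (mutation_complex n L Q)
      (walk_path n L Q (i # ks)) (\<lambda>_. c)"
    unfolding paved_def by blast
  let ?X = "disjoint_cells n L Q" and ?Z = "top_of_set (- {0 :: complex})"
  define e where "e = Edge Q i"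
  define e' where "e' = Edge (mutate i Q) i"
  \<comment> \<open>The edge is present as two cells, one for each direction. Being distinct, they
    can be wrapped around the circle in opposite senses, as the gluing demands.\<close>
  have ee': "e \<noteq> e'" using i(2) by (auto simp: e_def e'_def)
  \<comment> \<open>\<open>h\<close> wraps the edge \<open>e\<close> once around the circle and collapses everything else to \<open>1\<close>.\<close>
  define h :: "cell \<times> complex \<Rightarrow> complex" where
    "h = (\<lambda>(c, z). if c = e then exp (2 * pi * \<i> * z) else if c = e' then exp (- (2 * pi * \<i> * z)) else 1)"
  have h_e: "h (e, z) = exp (2 * pi * \<i> * z)" and h_e': "h (e', z) = exp (- (2 * pi * \<i> * z))"
    and h_1: "c \<noteq> e \<Longrightarrow> c \<noteq> e' \<Longrightarrow> h (c, z) = 1" for c z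
    using ee' by (auto simp: h_def)
  have h_0: "h (c, 0) = 1" for c by (simp add: h_def)
  have h_end: "h (c, 1) = 1" for c
    by (auto simp: h_def exp_minus)
  have "continuous_map ?X ?Z h"
    unfolding disjoint_cells_def
  proof (rule continuous_map_from_sum_topology)
    fix c
    have "continuous_on (closed_cell c) (\<lambda>x. h (c, x))"
    proof -
      consider "c = e" | "c = e'" | "c \<noteq> e" "c \<noteq> e'" by blast
      then show ?thesis
        by cases (auto simp: h_e h_e' h_1 intro!: continuous_intros)
    qed
    moreover have "h (c, x) \<noteq> 0" for x by (simp add: h_def)
    ultimately show "continuous_map (top_of_set (closed_cell c)) ?Z (\<lambda>x. h (c, x))"
      by (auto simp: continuous_map_in_subtopology)
  qed
  moreover have glued: "h a = h b" if ab: "(a, b) \<in> gluing" "a \<in> topspace ?X" "b \<in> topspace ?X" for a b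
    using ab(1) unfolding gluing_def
  proof (elim UnE CollectE exE conjE)
    fix P j t
    assume p: "(a, b) = ((Edge P j, complex_of_real t), Edge (mutate j P) j, complex_of_real (1 - t))"
    have *: "exp (- (2 * pi * \<i> * complex_of_real (1 - t))) = exp (2 * pi * \<i> * complex_of_real t)" for t
    proof -
      have "- (2 * pi * \<i> * complex_of_real (1 - t)) = 2 * pi * \<i> * complex_of_real t - 2 * pi * \<i>"
        by (simp add: algebra_simps)
      then show ?thesis by (simp add: exp_diff)
    qed
    have "mutate j P = Q \<longleftrightarrow> P = mutate j Q" "mutate j P = mutate j Q \<longleftrightarrow> P = Q"
      using mutate_mutate by metis+
    then have "Edge P j = e \<longleftrightarrow> j = i \<and> P = Q" "Edge P j = e' \<longleftrightarrow> j = i \<and> P = mutate j Q"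
      "Edge (mutate j P) j = e \<longleftrightarrow> j = i \<and> P = mutate j Q" "Edge (mutate j P) j = e' \<longleftrightarrow> j = i \<and> P = Q"
      unfolding e_def e'_def by auto
    then consider "Edge P j = e" "Edge (mutate j P) j = e'" | "Edge P j = e'" "Edge (mutate j P) j = e"
      | "Edge P j \<noteq> e" "Edge P j \<noteq> e'" "Edge (mutate j P) j \<noteq> e" "Edge (mutate j P) j \<noteq> e'"
      by blast
    then show "h a = h b"
    proof cases
      case 1
      then show ?thesis using p *[of t] by (simp add: h_e h_e')
    next
      case 2
      then show ?thesis using p *[of "1 - t"] by (simp add: h_e h_e')
    next
      case 3
      then show ?thesis using p by (simp add: h_1)
    qed
  next
    fix P js s
    assume p: "(a, b) = ((Face P js, cis (2 * pi * s)), walk_point P js s)" and s: "0 \<le> s" "s \<le> 1"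
    have F: "mutation_cycle n P js" "length js \<le> L"
      using ab(2) p by (auto simp: topspace_disjoint_cells cells_def)
    then have "js \<noteq> []" by (simp add: mutation_cycle_def)
    then obtain m where m: "m < length js"
      "walk_point P js s = (Edge (mutate_seq (take m js) P) (js ! m), of_real (s * real (length js) - real m))"
      using walk_piece[OF _ s] by metis
    \<comment> \<open>A boundary walk using \<open>e\<close> would be at \<open>Q\<close> before the
      step, one using \<open>e'\<close> after it. Hence the whole boundary is sent to 1, like the
      face.\<close>
    have "Q \<notin> visited P js"
      using free[OF F(2)] F(1) unfolding lies_on_cycle_def by blast
    then have v: "mutate_seq (take l js) P \<noteq> Q" if "l \<le> length js" for l
      using that unfolding visited_def by auto
    have "mutate_seq (take (Suc m) js) P = mutate (js ! m) (mutate_seq (take m js) P)"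
      using m(1) by (simp add: take_Suc_conv_app_nth)
    then have "Edge (mutate_seq (take m js) P) (js ! m) \<noteq> e'"
      using v[of "Suc m"] m(1) mutate_mutate unfolding e'_def by auto
    moreover have "Edge (mutate_seq (take m js) P) (js ! m) \<noteq> e"
      using v[of m] m(1) unfolding e_def by auto
    ultimately have "h b = 1"
      using p m(2) by (simp add: h_1)
    moreover have "h a = 1"
      using p by (simp add: h_1 e_def e'_def)
    ultimately show "h a = h b" by simp
  qed (auto simp: h_0 h_end)
  ultimately obtain g where g: "continuous_map (mutation_complex n L Q) ?Z g"
    and gh: "\<And>x. x \<in> topspace ?X \<Longrightarrow> g (glue_class ?X gluing x) = h x"
    unfolding mutation_complex_def
    using quotient_map_lift_exists[OF quotient_map_glue_class[of ?X gluing], of ?Z h]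
      glue_class_imp_eq[of ?X gluing _ _ h] by metis
  define N where "N = real (length (i # ks))"
  have N: "N > 0" by (simp add: N_def)
  \<comment> \<open>A logarithm of the image loop: the free edge takes the time up to
    \<open>1 / N\<close>, and clamping at 1 keeps the loop at its base point afterwards.\<close>
  define p :: "real \<Rightarrow> complex" where "p = (\<lambda>s. 2 * pi * \<i> * of_real (min (s * N) 1))"
  have lift: "g (walk_path n L Q (i # ks) s) = exp (p s)" if s: "s \<in> {0..1}" for s
  proof -
    obtain m where m: "m < length (i # ks)" "real m \<le> s * N" "s * N \<le> real m + 1"
      "walk_point Q (i # ks) s =
        (Edge (mutate_seq (take m (i # ks)) Q) ((i # ks) ! m), of_real (s * N - real m))"
      using walk_piece[of "i # ks" s Q] s unfolding N_def by auto
    have sub: "set (i # ks) \<subseteq> {1..n}" using ks i by simp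
    have "s * N - real m \<in> closed_segment 0 1"
      using m by (auto simp: closed_segment_eq_real_ivl)
    then have "complex_of_real (s * N - real m) \<in> closed_segment (of_real 0) (of_real 1)"
      by (simp only: of_real_closed_segment)
    moreover have "(i # ks) ! m \<in> {1..n}"
      using m(1) sub nth_mem by blast
    ultimately have "walk_point Q (i # ks) s \<in> topspace ?X"
      using m(4) mutate_seq_take_in_class[OF sub, of m Q]
      by (auto simp: topspace_disjoint_cells cells_def)
    then have "g (walk_path n L Q (i # ks) s) = h (walk_point Q (i # ks) s)"
      unfolding walk_path_def by (rule gh)
    also have "\<dots> = exp (p s)"
    proof (cases m)
      case 0
      then show ?thesis
        using m by (simp add: h_e e_def[symmetric] p_def)
    next
      case (Suc l)
      then have "(i # ks) ! m \<noteq> i"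
        using m(1) ks(2) by auto
      then have "h (walk_point Q (i # ks) s) = 1"
        unfolding m(4) by (intro h_1) (auto simp: e_def e'_def)
      moreover have "min (s * N) 1 = 1" using m(2) Suc by simp
      ultimately show ?thesis by (simp add: p_def)
    qed
    finally show ?thesis .
  qed
  have "homotopic_with (\<lambda>p. p 1 = p 0) (top_of_set {0..1}) ?Z
      (g \<circ> walk_path n L Q (i # ks)) (g \<circ> (\<lambda>_. c))"
    by (rule homotopic_with_compose_continuous_map_left[OF c g]) auto
  \<comment> \<open>The constant path is written as a degenerate \<open>linepath\<close>, whose
    winding number is known to be 0.\<close>
  then have "homotopic_with (\<lambda>p. p 1 = p 0) (top_of_set {0..1}) ?Z (exp \<circ> p) (linepath (g c) (g c))"
    by (rule homotopic_with_eq) (auto simp: lift linepath_refl)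
  then have "homotopic_loops (- {0}) (exp \<circ> p) (linepath (g c) (g c))"
    unfolding homotopic_loops_def pathfinish_def pathstart_def .
  then have "winding_number (exp \<circ> p) 0 = winding_number (linepath (g c) (g c)) 0"
    and "path_image (linepath (g c) (g c)) \<subseteq> - {0}"
    by (auto dest: winding_number_homotopic_loops homotopic_loops_imp_subset)
  then have "winding_number (exp \<circ> p) 0 = 0" by simp
  moreover have "path p"
    unfolding path_def p_def by (intro continuous_intros)
  then have "winding_number (exp \<circ> p) 0 = (pathfinish p - pathstart p) / (2 * of_real pi * \<i>)"
    by (rule winding_number_compose_exp)
  moreover have "pathfinish p = 2 * pi * \<i>" "pathstart p = 0"
    by (simp_all add: p_def pathfinish_def pathstart_def N_def)
  ultimately show False by simp
qed


theorem theorem7p1: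
  fixes n k :: nat and R Q :: quiver
  assumes "n \<ge> 4" and "k \<ge> 1"
    and "quiver_on (n - 1) R"
    and "\<forall>i j. 1 \<le> i \<and> i < j \<and> j \<le> n - 1 \<longrightarrow> R i j \<ge> 2"
    and "quiver_on n Q"
    and "full_subquiver (n - 1) Q = mutate_seq (concat (replicate k [2, 1])) R"
    and "\<forall>i \<in> {1..n - 1}. Q i n \<ge> 2"
  shows "(\<forall>P ks. length ks \<le> 4 * k + 1 \<longrightarrow> \<not> lies_on_cycle n Q P ks) \<and>
    (let c = [n] @ concat (replicate k [1, 2]) @ rev [1..<n] @ concat (replicate k [2, 1])
     in mutation_cycle n Q c \<and> length c = 4 * k + n \<and> \<not> paved n (4 * k + 1) Q c)"
proof -
  interpret wound_quiver n k R Q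
  proof
    show "full_subquiver (n - 1) Q = winding R (2 * k)"
      using assms(6) by (simp add: winding_def concat_replicate_alternating)
  qed (use assms in auto)
  have short: "\<not> lies_on_cycle n Q P ks" if "length ks \<le> 4 * k + 1" for P ks
    using base_not_on_short_cycle[OF that] .
  let ?ks = "alternating 1 2 (2 * k) @ rev [1..<n] @ alternating 2 1 (2 * k)"
  have "\<not> paved n (4 * k + 1) Q (n # ?ks)"
  proof (rule not_paved_free_edge)
    show "n \<in> {1..n}" using assms(1) by simp
    have "mutate n Q 1 n \<noteq> Q 1 n"
      using sink[of 1] assms(1) by (simp add: mutate_base)
    then show "mutate n Q \<noteq> Q" by metis
    show "set ?ks \<subseteq> {1..n}" "n \<notin> set ?ks"
      using set_alternating[of 1 2 "2 * k"] set_alternating[of 2 1 "2 * k"] assms(1) by auto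
  qed (rule short)
  moreover have "length (n # ?ks) = 4 * k + n"
    using assms(1) by simp
  ultimately show ?thesis
    using short base_long_cycle by (simp only: concat_replicate_alternating Let_def append_Cons append_Nil) blast
qed

end
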